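(* Let $\{P_n\}_{n=0}^{\infty}$ be a sequence of polynomials (in the variable $x=x(s)$, $\deg P_n=n$) orthogonal with respect to a positive weight function $w(x)$. The following properties are equivalent: (a) There exist a polynomial $\pi(x)$ of degree at most $4$ and sequences $\{a_{n,n+k}\}_{n\ge2}$, $-2\le k\le 2$, with $a_{n,n-2}\neq0$, such that $$\pi(x)\,\mathbb{D}_x^2P_n(x)=\sum_{k=-2}^{2}a_{n,n+k}P_{n+k}(x),\qquad n\ge 2.$$ (b) There exists a polynomial $\pi(x)$ of degree at most $4$ such that $\{\mathbb{D}_x^2P_n\}_{n=2}^{\infty}$ is orthogonal with respect to $\pi(x)w(x)$. (c) There exist two polynomials $\phi(x)$ and $\psi(x)$, of degree at most two and of degree one respectively, and constants $\lambda_n$, such that $$\phi(x)\,\mathbb{D}_x^2P_n(x)+\psi(x)\,\mathbb{S}_x\mathbb{D}_xP_n(x)+\lambda_nP_n(x)=0,\qquad n\ge5.$$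
   Context: The lattice is $x(s)=c_1q^{-s}+c_2q^{s}+c_3$ with $c_1\ne0$ if $q\neq1$, and $x(s)=c_4s^2+c_5s+c_6$ with $c_4\neq0$ if $q=1$; $q>0$ is fixed. For a polynomial $f$, $\mathbb{D}_xf(x(s))=\dfrac{f(x(s+\frac12))-f(x(s-\frac12))}{x(s+\frac12)-x(s-\frac12)}$ and $\mathbb{S}_xf(x(s))=\dfrac{f(x(s+\frac12))+f(x(s-\frac12))}{2}$; both map polynomials in $x$ to polynomials in $x$. Orthogonality of $\{P_n\}$ with respect to a weight function $w$ (on an interval $(a,b)$) means $\int_a^bP_m(x)P_n(x)w(x)\,dx=d_n\delta_{mn}$ with $d_n>0$. Orthogonality of $\{\mathbb{D}_x^2P_n\}_{n\ge2}$ with respect to $\pi w$ means $\int_a^b\mathbb{D}_x^2P_m\,\mathbb{D}_x^2P_n\,\pi w\,dx$ is $0$ for $m\neq n$ and nonzero for $m=n$. *)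

theory Defs
  imports "HOL-Analysis.Analysis" "HOL-Computational_Algebra.Polynomial"
begin

definition nonuniform_lattice :: "real \<Rightarrow> (real \<Rightarrow> real) \<Rightarrow> bool" where
  "nonuniform_lattice q x \<longleftrightarrow>
     (q \<noteq> 1 \<and> (\<exists>c1 c2 c3. c1 \<noteq> 0 \<and> x = (\<lambda>s. c1 * q powr (- s) + c2 * q powr s + c3))) \<or>
     (q = 1 \<and> (\<exists>c4 c5 c6. c4 \<noteq> 0 \<and> x = (\<lambda>s. c4 * s\<^sup>2 + c5 * s + c6)))"

text \<open>
  The operators act on polynomials in the lattice variable and return the polynomial determined
  by the divided difference, respectively the mean, along the lattice. At most one \<open>s\<close> makes the
  denominator of the divided difference vanish and is left out. Lemmas \<open>poly_Dx\<close> and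
  \<open>poly_Sx\<close> below show that for a lattice with \<open>q > 0\<close> the polynomials described here
  exist and are unique. Real \<open>s\<close> suffices: the polynomial identities extend to complex \<open>s\<close>
  (as used for the Askey-Wilson operator, where \<open>q\<close> to the power \<open>s\<close> lies on the unit circle)
  by analytic continuation.
\<close>

definition Dx :: "(real \<Rightarrow> real) \<Rightarrow> real poly \<Rightarrow> real poly" where
  "Dx x f = (THE g. \<forall>s. x (s + 1/2) \<noteq> x (s - 1/2) \<longrightarrow>
     poly g (x s) = (poly f (x (s + 1/2)) - poly f (x (s - 1/2))) / (x (s + 1/2) - x (s - 1/2)))"

definition Sx :: "(real \<Rightarrow> real) \<Rightarrow> real poly \<Rightarrow> real poly" where
  "Sx x f = (THE g. \<forall>s. poly g (x s) = (poly f (x (s + 1/2)) + poly f (x (s - 1/2))) / 2)"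

text \<open>
  The interval may be unbounded, hence the extended real end points. Integrability is required
  explicitly, since the integral of a non-integrable function is 0 by convention.
\<close>

definition orthogonal_polys :: "ereal \<Rightarrow> ereal \<Rightarrow> (real \<Rightarrow> real) \<Rightarrow> (nat \<Rightarrow> real poly) \<Rightarrow> bool" where
  "orthogonal_polys a b w P \<longleftrightarrow>
     (\<forall>m n. interval_lebesgue_integrable lborel a b (\<lambda>t. poly (P m) t * poly (P n) t * w t)) \<and>
     (\<exists>d. (\<forall>n. d n > 0) \<and>
       (\<forall>m n. (LBINT t=a..b. poly (P m) t * poly (P n) t * w t) = (if m = n then d n else 0)))"

definition orthogonal_D2 ::
  "(real \<Rightarrow> real) \<Rightarrow> ereal \<Rightarrow> ereal \<Rightarrow> (real \<Rightarrow> real) \<Rightarrow> (nat \<Rightarrow> real poly) \<Rightarrow> bool" where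
  "orthogonal_D2 x a b v P \<longleftrightarrow>
     (\<forall>m\<ge>2. \<forall>n\<ge>2.
       interval_lebesgue_integrable lborel a b
         (\<lambda>t. poly (Dx x (Dx x (P m))) t * poly (Dx x (Dx x (P n))) t * v t) \<and>
       ((LBINT t=a..b. poly (Dx x (Dx x (P m))) t * poly (Dx x (Dx x (P n))) t * v t) = 0
         \<longleftrightarrow> m \<noteq> n))"

lemma powr_half_shift:
  fixes q :: real
  assumes "q > 0"
  shows "q powr (s + 1/2) = q powr s * q powr (1/2)"
    "q powr (s - 1/2) = q powr s / q powr (1/2)"
    "q powr (- (s + 1/2)) = 1 / q powr s / q powr (1/2)"
    "q powr (- (s - 1/2)) = 1 / q powr s * q powr (1/2)"
proof -
  show 1: "q powr (s + 1/2) = q powr s * q powr (1/2)" by (rule powr_add)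
  show 2: "q powr (s - 1/2) = q powr s / q powr (1/2)" by (rule powr_diff)
  show "q powr (- (s + 1/2)) = 1 / q powr s / q powr (1/2)"
    unfolding powr_minus 1 by (simp only: divide_inverse inverse_mult_distrib inverse_inverse_eq mult_1_left)
  show "q powr (- (s - 1/2)) = 1 / q powr s * q powr (1/2)"
    unfolding powr_minus 2 by (simp only: divide_inverse inverse_mult_distrib inverse_inverse_eq mult_1_left)
qed

lemma lattice_mean_and_diff:
  assumes "q > 0" "nonuniform_lattice q x"
  obtains p u :: "real poly" where
    "\<And>s. (x (s + 1/2) + x (s - 1/2)) / 2 = poly p (x s)"
    "\<And>s. ((x (s + 1/2) - x (s - 1/2)) / 2)\<^sup>2 = poly u (x s)"
proof -
  consider (Q) c1 c2 c3 where "x = (\<lambda>s. c1 * q powr (- s) + c2 * q powr s + c3)"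
    | (L) c4 c5 c6 where "x = (\<lambda>s. c4 * s\<^sup>2 + c5 * s + c6)"
    using assms(2) unfolding nonuniform_lattice_def by blast
  then show thesis
  proof cases
    case Q
    define r where "r = q powr (1/2)"
    have r: "r > 0" using assms(1) by (simp add: r_def)
    have sh: "q powr (s + 1/2) = q powr s * r" "q powr (s - 1/2) = q powr s / r"
      "q powr (- (s + 1/2)) = 1 / q powr s / r" "q powr (- (s - 1/2)) = 1 / q powr s * r"
      "q powr (- s) = 1 / q powr s" for s
      unfolding r_def by (rule powr_half_shift[OF assms(1)] powr_minus_divide)+
    have e: "q powr s \<noteq> 0" for s using assms(1) by simp
    show ?thesis
    proof (rule that[of "[: c3 * (1 - (r + 1/r)/2), (r + 1/r)/2 :]"
          "smult ((r - 1/r)\<^sup>2 / 4) ([:- c3, 1:]\<^sup>2 - [:4 * c1 * c2:])"])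
      fix s
      show "(x (s + 1/2) + x (s - 1/2)) / 2 = poly [: c3 * (1 - (r + 1/r)/2), (r + 1/r)/2 :] (x s)"
        unfolding Q sh using r e[of s] by (simp add: field_simps)
      have "(x (s + 1/2) - x (s - 1/2)) / 2 = (r - 1/r) / 2 * (c2 * q powr s - c1 / q powr s)"
        unfolding Q sh using r e[of s] by (simp add: field_simps)
      hence "((x (s + 1/2) - x (s - 1/2)) / 2)\<^sup>2
          = ((r - 1/r) / 2)\<^sup>2 * (c2 * q powr s - c1 / q powr s)\<^sup>2"
        by (simp only: power_mult_distrib)
      also have "(c2 * q powr s - c1 / q powr s)\<^sup>2 = (x s - c3)\<^sup>2 - 4*c1*c2"
      proof -
        have *: "(c2 * y - c1 / y)\<^sup>2 = (c1 / y + c2 * y)\<^sup>2 - 4*c1*c2" if "y \<noteq> 0" for y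
        proof -
          have 1: "(c1 / y) * (c2 * y) = c1 * c2" using that by simp
          have "(v - u)\<^sup>2 = (u + v)\<^sup>2 - 4 * (u * v)" for u v :: real
            by (simp add: power2_eq_square algebra_simps)
          from this[of "c2 * y" "c1 / y"] show ?thesis by (simp only: 1 mult.assoc)
        qed
        have "x s - c3 = c1 / q powr s + c2 * q powr s" unfolding Q sh(5) by simp
        thus ?thesis using *[OF e[of s]] by simp
      qed
      finally have "((x (s + 1/2) - x (s - 1/2)) / 2)\<^sup>2
          = ((r - 1/r) / 2)\<^sup>2 * ((x s - c3)\<^sup>2 - 4*c1*c2)" .
      thus "((x (s + 1/2) - x (s - 1/2)) / 2)\<^sup>2
          = poly (smult ((r - 1/r)\<^sup>2 / 4) ([:- c3, 1:]\<^sup>2 - [:4 * c1 * c2:])) (x s)"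
        by (simp add: power_divide)
    qed
  next
    case L
    show ?thesis
    proof (rule that[of "[: c4/4, 1 :]" "[: c5\<^sup>2/4 - c4 * c6, c4 :]"])
      fix s
      show "(x (s + 1/2) + x (s - 1/2)) / 2 = poly [: c4/4, 1 :] (x s)"
        unfolding L by (simp add: field_simps power2_eq_square)
      show "((x (s + 1/2) - x (s - 1/2)) / 2)\<^sup>2 = poly [: c5\<^sup>2/4 - c4 * c6, c4 :] (x s)"
        unfolding L by (simp add: field_simps power2_eq_square)
    qed
  qed
qed

lemma lattice_infinite_range:
  assumes "q > 0" "nonuniform_lattice q x"
  shows "infinite (x ` {s. x (s + 1/2) \<noteq> x (s - 1/2)})"
proof
  let ?B = "{s. x (s + 1/2) = x (s - 1/2)}"
  assume fin: "finite (x ` {s. x (s + 1/2) \<noteq> x (s - 1/2)})"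
  have "finite ?B \<and> (\<forall>y. finite {s. x s = y})"
    using assms(2) unfolding nonuniform_lattice_def
  proof (elim disjE conjE exE)
    fix c1 c2 c3 assume q: "q \<noteq> 1" and c: "c1 \<noteq> 0"
      and x: "x = (\<lambda>s. c1 * q powr (- s) + c2 * q powr s + c3)"
    have inj: "inj (\<lambda>s. q powr s)"
      using assms(1) q by (auto simp: inj_def powr_inj)
    have fib: "finite {s. poly p (q powr s) = 0}" if "p \<noteq> 0" for p
      using finite_vimageI[OF poly_roots_finite[OF that] inj] by (simp add: vimage_def)
    have "finite {s. x s = y}" for y
    proof (rule finite_subset[OF _ fib[of "[:c1, c3 - y, c2:]"]])
      show "{s. x s = y} \<subseteq> {s. poly [:c1, c3 - y, c2:] (q powr s) = 0}"
        using assms(1) by (auto simp: x powr_minus field_simps)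
    qed (use c in auto)
    moreover have "finite ?B"
    proof (rule finite_subset[OF _ fib[of "[:c1, 0, - c2:]"]])
      define r where "r = q powr (1/2)"
      have r: "r > 0" using assms(1) by (simp add: r_def)
      have "r\<^sup>2 = q" using assms(1) by (simp add: r_def powr_half_sqrt)
      hence r1: "r * r \<noteq> 1" using q by (simp add: power2_eq_square)
      have sh: "q powr (s + 1/2) = q powr s * r" "q powr (s - 1/2) = q powr s / r"
        "q powr (- (s + 1/2)) = 1 / q powr s / r" "q powr (- (s - 1/2)) = 1 / q powr s * r" for s
        unfolding r_def by (rule powr_half_shift[OF assms(1)])+
      show "?B \<subseteq> {s. poly [:c1, 0, - c2:] (q powr s) = 0}"
      proof
        fix s assume "s \<in> ?B"
        hence eq: "x (s + 1/2) - x (s - 1/2) = 0" by simp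
        define y where "y = q powr s"
        have y: "y > 0" using assms(1) by (simp add: y_def)
        have "x (s + 1/2) - x (s - 1/2) = (1 - r * r) * (c1 - c2 * y\<^sup>2) / (r * y)"
          unfolding x sh y_def[symmetric] using r y by (simp add: field_simps power2_eq_square)
        hence "c1 - c2 * y\<^sup>2 = 0" using eq r y r1 by simp
        thus "s \<in> {s. poly [:c1, 0, - c2:] (q powr s) = 0}"
          by (simp add: y_def[symmetric] power2_eq_square algebra_simps)
      qed
    qed (use c in auto)
    ultimately show ?thesis by blast
  next
    fix c4 c5 c6 :: real assume c: "c4 \<noteq> 0" and x: "x = (\<lambda>s. c4 * s\<^sup>2 + c5 * s + c6)"
    have "finite {s. x s = y}" for y
    proof (rule finite_subset[OF _ poly_roots_finite[of "[:c6 - y, c5, c4:]"]])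
      show "{s. x s = y} \<subseteq> {s. poly [:c6 - y, c5, c4:] s = 0}"
        by (auto simp: x power2_eq_square algebra_simps)
    qed (use c in auto)
    moreover have "finite ?B"
    proof (rule finite_subset[OF _ poly_roots_finite[of "[:c5, 2 * c4:]"]])
      show "?B \<subseteq> {s. poly [:c5, 2 * c4:] s = 0}"
        by (auto simp: x power2_eq_square field_simps)
    qed (use c in auto)
    ultimately show ?thesis by blast
  qed
  hence "finite ?B" and fib: "\<And>y. finite {s. x s = y}" by simp_all
  have "finite (\<Union>y\<in>x ` {s. x (s + 1/2) \<noteq> x (s - 1/2)}. {s. x s = y})"
    by (intro finite_UN_I fin fib)
  with \<open>finite ?B\<close>
  have "finite (?B \<union> (\<Union>y\<in>x ` {s. x (s + 1/2) \<noteq> x (s - 1/2)}. {s. x s = y}))"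
    by (rule finite_UnI)
  also have "?B \<union> (\<Union>y\<in>x ` {s. x (s + 1/2) \<noteq> x (s - 1/2)}. {s. x s = y}) = UNIV"
    by auto
  finally have "finite (UNIV :: real set)" .
  thus False by (simp add: infinite_UNIV_char_0)
qed

lemma lattice_poly_unique:
  assumes "q > 0" "nonuniform_lattice q x"
    and "\<And>s. x (s + 1/2) \<noteq> x (s - 1/2) \<Longrightarrow> poly f (x s) = poly g (x s)"
  shows "f = g"
proof (rule ccontr)
  assume "f \<noteq> g"
  hence "finite {t. poly (f - g) t = 0}" by (intro poly_roots_finite) simp
  moreover have "x ` {s. x (s + 1/2) \<noteq> x (s - 1/2)} \<subseteq> {t. poly (f - g) t = 0}"
    using assms(3) by auto
  ultimately show False
    using lattice_infinite_range[OF assms(1,2)] by (auto dest: finite_subset)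
qed

lemma lattice_ops_exist:
  assumes "q > 0" "nonuniform_lattice q x"
  shows "\<exists>g h. \<forall>s. poly f (x (s + 1/2)) - poly f (x (s - 1/2)) = poly g (x s) * (x (s + 1/2) - x (s - 1/2))
     \<and> (poly f (x (s + 1/2)) + poly f (x (s - 1/2))) / 2 = poly h (x s)"
proof (rule lattice_mean_and_diff[OF assms])
  fix p u :: "real poly"
  assume p: "\<And>s. (x (s + 1/2) + x (s - 1/2)) / 2 = poly p (x s)"
    and u: "\<And>s. ((x (s + 1/2) - x (s - 1/2)) / 2)\<^sup>2 = poly u (x s)"
  show ?thesis
  proof (induction f)
    case 0
    show ?case by (rule exI[of _ 0], rule exI[of _ 0]) simp
  next
    case (pCons a f)
    obtain g h where
      gh: "\<forall>s. poly f (x (s + 1/2)) - poly f (x (s - 1/2)) = poly g (x s) * (x (s + 1/2) - x (s - 1/2))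
        \<and> (poly f (x (s + 1/2)) + poly f (x (s - 1/2))) / 2 = poly h (x s)"
      using pCons.IH by (elim exE) (rule that)
    note g = gh[rule_format, THEN conjunct1] and h = gh[rule_format, THEN conjunct2]
    show ?case
    proof (rule exI[of _ "h + p * g"], rule exI[of _ "[:a:] + p * h + u * g"], intro allI conjI)
      fix s
      define X Y F G where d: "X = x (s + 1/2)" "Y = x (s - 1/2)" "F = poly f X" "G = poly f Y"
      have g': "F - G = poly g (x s) * (X - Y)" using g[of s] by (simp add: d)
      show "poly (pCons a f) (x (s + 1/2)) - poly (pCons a f) (x (s - 1/2))
          = poly (h + p * g) (x s) * (x (s + 1/2) - x (s - 1/2))"
      proof -
        have "X * F - Y * G = (F + G) / 2 * (X - Y) + (X + Y) / 2 * (F - G)"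
          by (simp add: field_simps)
        also have "\<dots> = (poly h (x s) + poly p (x s) * poly g (x s)) * (X - Y)"
          unfolding g' h[of s, folded d] p[of s, folded d] by (simp add: algebra_simps)
        finally show ?thesis by (simp add: d algebra_simps)
      qed
      show "(poly (pCons a f) (x (s + 1/2)) + poly (pCons a f) (x (s - 1/2))) / 2
          = poly ([:a:] + p * h + u * g) (x s)"
      proof -
        have "(X * F + Y * G) / 2 = (X + Y) / 2 * ((F + G) / 2) + (X - Y) * (F - G) / 4"
          by (simp add: field_simps)
        also have "(X - Y) * (F - G) / 4 = ((X - Y) / 2)\<^sup>2 * poly g (x s)"
          unfolding g' by (simp add: power2_eq_square)
        finally have *: "(X * F + Y * G) / 2 = poly p (x s) * poly h (x s) + poly u (x s) * poly g (x s)"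
          unfolding h[of s, folded d] p[of s, folded d] u[of s, folded d] .
        have "(poly (pCons a f) X + poly (pCons a f) Y) / 2 = a + (X * F + Y * G) / 2"
          by (simp add: d field_simps)
        thus ?thesis unfolding * by (simp add: d)
      qed
    qed
  qed
qed

lemma poly_Dx:
  assumes "q > 0" "nonuniform_lattice q x"
    and "x (s + 1/2) \<noteq> x (s - 1/2)"
  shows "poly (Dx x f) (x s)
    = (poly f (x (s + 1/2)) - poly f (x (s - 1/2))) / (x (s + 1/2) - x (s - 1/2))"
proof -
  let ?Q = "\<lambda>g. \<forall>s. x (s + 1/2) \<noteq> x (s - 1/2) \<longrightarrow>
     poly g (x s) = (poly f (x (s + 1/2)) - poly f (x (s - 1/2))) / (x (s + 1/2) - x (s - 1/2))"
  obtain g h where gh: "\<forall>s. poly f (x (s + 1/2)) - poly f (x (s - 1/2)) = poly g (x s) * (x (s + 1/2) - x (s - 1/2))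
      \<and> (poly f (x (s + 1/2)) + poly f (x (s - 1/2))) / 2 = poly h (x s)"
    using lattice_ops_exist[OF assms(1,2), of f] by (elim exE) (rule that)
  have g: "?Q g" using gh[rule_format, THEN conjunct1] by simp
  have "?Q (Dx x f)"
    unfolding Dx_def
    by (rule theI[where P = ?Q, OF g]) (rule lattice_poly_unique[OF assms(1,2)], use g in simp)
  thus ?thesis using assms(3) by simp
qed

lemma poly_Sx:
  assumes "q > 0" "nonuniform_lattice q x"
  shows "poly (Sx x f) (x s) = (poly f (x (s + 1/2)) + poly f (x (s - 1/2))) / 2"
proof -
  let ?Q = "\<lambda>g. \<forall>s. poly g (x s) = (poly f (x (s + 1/2)) + poly f (x (s - 1/2))) / 2"
  obtain h g where gh: "\<forall>s. poly f (x (s + 1/2)) - poly f (x (s - 1/2)) = poly h (x s) * (x (s + 1/2) - x (s - 1/2))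
      \<and> (poly f (x (s + 1/2)) + poly f (x (s - 1/2))) / 2 = poly g (x s)"
    using lattice_ops_exist[OF assms, of f] by (elim exE) (rule that)
  have g: "?Q g" using gh[rule_format, THEN conjunct2] by simp
  have "?Q (Sx x f)"
    unfolding Sx_def
  proof (rule theI[where P = ?Q, OF g])
    fix k assume k: "?Q k"
    show "k = g"
      by (rule lattice_poly_unique[OF assms]) (simp only: k[rule_format] g[rule_format])
  qed
  thus ?thesis by (rule spec)
qed

end

theory Submission
  imports Defs
begin

text \<open>
Along the lattice \<open>x\<close>, the difference operator \<open>D\<close> and the mean operator \<open>S\<close> are determined
on polynomials by \<open>D 1 = 0\<close>, \<open>S 1 = 1\<close> and the two rules
\<open>D (x f) = S f + p D f\<close>, \<open>S (x f) = U D f + p S f\<close>, where \<open>p = \<alpha> x + \<beta>\<close> is the mean and \<open>U\<close> the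
square of half the difference of \<open>x\<close> at the two neighbouring half steps. As \<open>\<alpha> \<ge> 1\<close>, the leading
coefficients produced by \<open>D\<close> and \<open>S\<close> are positive, so \<open>D\<close> is onto with the constants as kernel.
Write \<open>L f = \<integral> f w\<close> for the functional of the weight and \<open>R n\<close> for \<open>D (D (P n))\<close>.

The equivalence of (a) and (b) is a comparison of coefficients: \<open>L (\<pi> R m P j)\<close> vanishes
for \<open>j < m - 2\<close> and not for \<open>j = m - 2\<close>, if and only if the \<open>R n\<close> are orthogonal for \<open>\<pi> L\<close>.

From (b) to (c). The first step is to expand \<open>x D (P n)\<close> in the polynomials \<open>D (P j)\<close>. One more
application of \<open>D\<close> gives \<open>2 \<alpha> D (x D (P n)) = D (D (x P n)) + (x - 2 \<beta>) R n\<close>, and both terms on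
the right involve only neighbouring \<open>R j\<close>, the second one by orthogonality. Hence only
\<open>j = n - 1, n, n + 1\<close> occur, except that \<open>D\<close> does not see the constant \<open>D (P 1)\<close>, whose
coefficient remains unknown. The identity \<open>D (x\<^sup>2 f) = 2 p D (x f) - w1 D f\<close>, with \<open>w1 = p\<^sup>2 - U\<close>,
compares \<open>x\<^sup>2 D (P n)\<close> with banded quantities and forces this coefficient to vanish for \<open>n \<ge> 3\<close>.
Therefore the functional \<open>u\<close> that takes \<open>d 1\<close> times the coefficient of \<open>D (P 1)\<close> satisfies
\<open>u (D f) = L (\<psi> f)\<close> and \<open>u (x D f) = L (G f)\<close> with \<open>\<psi> = P 1\<close> and \<open>G\<close> of degree at most 2. The same
identity then gives \<open>u (g D f) = L ((\<phi> D g + \<psi> S g) f)\<close> for all \<open>g\<close>, with \<open>\<phi> = G - p \<psi>\<close>. The left-hand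
side at \<open>g = D h\<close> is symmetric in \<open>f\<close> and \<open>h\<close>, so \<open>T = \<phi> D D + \<psi> S D\<close> is symmetric for \<open>L\<close>. It does
not raise degrees, and so it is diagonal on the \<open>P n\<close>.

From (c) to (a). A second-order commutation rule for \<open>T\<close> and \<open>x\<close> expresses \<open>T (P n)\<close> through
\<open>T (P m)\<close> with \<open>n < m \<le> n + 4\<close>, so the equation holds for every \<open>n\<close>. Then \<open>L (T f) = 0\<close> for
all \<open>f\<close>, which is the Pearson equation \<open>L (\<phi> D h + \<psi> S h) = 0\<close>, and the product rules turn it into
\<open>L (S h T f) = - L (D h T' f)\<close> with \<open>T' = \<phi> S D + U \<psi> D D\<close>. For \<open>\<pi> = \<phi>\<^sup>2 - U \<psi>\<^sup>2\<close> one has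
\<open>\<pi> D D = \<phi> T - \<psi> T'\<close>, so that \<open>L (\<pi> R n h)\<close> is the \<open>n\<close>-th eigenvalue of \<open>T\<close> times
\<open>L ((\<phi> h + S k) P n)\<close>, where \<open>D k = \<psi> h\<close>. This vanishes if \<open>h\<close> has degree below \<open>n - 2\<close>; if \<open>h\<close> has
degree \<open>n - 2\<close>, it is a nonzero multiple of the product of the \<open>n\<close>-th and the next eigenvalue. An
eigenvalue can vanish only for \<open>n = 0\<close>: otherwise \<open>T' (P n) = 0\<close> and then \<open>\<pi> = 0\<close>, which contradicts
the Pearson equation.
\<close>

section \<open>Polynomials and linear operators\<close>

definition var :: "real poly" where "var = [:0, 1:]"

definition cst :: "real \<Rightarrow> real poly" where "cst c = [:c:]"

lemma cst_hom:
  "cst (a + b) = cst a + cst b" "cst (a - b) = cst a - cst b" "cst (a * b) = cst a * cst b"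
  "cst 0 = 0" "cst 1 = 1" "cst (- a) = - cst a" "cst (a ^ n) = cst a ^ n" "cst (numeral k) = numeral k"
  by (simp_all add: cst_def one_pCons poly_const_pow numeral_poly)

lemma smult_cst: "smult c f = cst c * f"
  by (simp add: cst_def)

lemma pCons_var: "pCons a f = cst a + var * f"
  by (simp add: cst_def var_def)

lemma coeff_cst_mult [simp]: "coeff (cst c * f) n = c * coeff f n"
  by (simp add: cst_def)

lemma coeff_var_mult: "coeff (var * f) n = (if n = 0 then 0 else coeff f (n - 1))"
  by (cases n) (simp_all add: var_def)

lemma degree_cst [simp]: "degree (cst c) = 0" and degree_var [simp]: "degree var = 1"
  by (simp_all add: cst_def var_def)

lemma poly_cst [simp]: "poly (cst c) t = c" and poly_var [simp]: "poly var t = t"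
  by (simp_all add: cst_def var_def)

lemma poly_var_induct [case_names const var_mult add]:
  assumes "\<And>c. Q (cst c)" "\<And>f. Q f \<Longrightarrow> Q (var * f)" "\<And>f g. Q f \<Longrightarrow> Q g \<Longrightarrow> Q (f + g)"
  shows "Q f"
proof (induction f)
  case 0
  show ?case using assms(1)[of 0] by (simp add: cst_hom)
next
  case (pCons a f)
  show ?case unfolding pCons_var by (intro assms(1,2,3) pCons.IH)
qed

lemma coeff_mult_top:
  fixes f g :: "real poly"
  assumes "degree f \<le> a" "degree g \<le> b"
  shows "coeff (f * g) (a + b) = coeff f a * coeff g b"
proof -
  have "coeff (f * g) (a + b) = (\<Sum>i\<le>a + b. if i = a then coeff f a * coeff g b else 0)"
    unfolding coeff_mult
  proof (intro sum.cong refl)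
    fix i assume "i \<in> {..a + b}"
    hence "i < a \<Longrightarrow> coeff g (a + b - i) = 0" "i > a \<Longrightarrow> coeff f i = 0"
      using assms by (auto intro!: coeff_eq_0)
    thus "coeff f i * coeff g (a + b - i) = (if i = a then coeff f a * coeff g b else 0)"
      by (cases i a rule: linorder_cases) auto
  qed
  thus ?thesis by simp
qed

lemma degree_le_1_eq:
  fixes f :: "real poly"
  assumes "degree f \<le> 1"
  shows "f = [:coeff f 0, coeff f 1:]"
proof (rule poly_eqI)
  fix i
  show "coeff f i = coeff [:coeff f 0, coeff f 1:] i"
    using assms by (cases i; cases "i - 1") (auto simp: coeff_pCons coeff_eq_0)
qed

definition linear_op :: "(real poly \<Rightarrow> real poly) \<Rightarrow> bool" where
  "linear_op F \<longleftrightarrow> (\<forall>f g. F (f + g) = F f + F g) \<and> (\<forall>c f. F (cst c * f) = cst c * F f)"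

lemma linear_opD:
  assumes "linear_op F"
  shows "F (f + g) = F f + F g" "F (cst c * f) = cst c * F f" "F (f - g) = F f - F g"
    "F 0 = 0" "F (- f) = - F f"
proof -
  show add: "F (f + g) = F f + F g" for f g using assms by (simp add: linear_op_def)
  show sc: "F (cst c * f) = cst c * F f" for c f using assms by (simp add: linear_op_def)
  show zero: "F 0 = 0" using sc[of 0 0] by (simp add: cst_hom)
  show neg: "F (- f) = - F f" for f using sc[of "-1" f] by (simp add: cst_hom)
  show "F (f - g) = F f - F g" using add[of f "- g"] neg[of g] by simp
qed

text \<open>
Eliminating leading coefficients one at a time. The shift \<open>k\<close> is the amount by which the operator
lowers the degree: 1 for \<open>D\<close> and 0 for operators that preserve it.
\<close>

lemma linear_op_surj:
  assumes F: "linear_op F"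
    and lead: "\<And>n. \<exists>f. (\<forall>i\<ge>n + k + 1. coeff f i = 0) \<and> (\<forall>i\<ge>n + 1. coeff (F f) i = 0) \<and> coeff (F f) n \<noteq> 0"
    and g: "\<forall>i\<ge>n. coeff g i = 0"
  shows "\<exists>f. F f = g \<and> (\<forall>i\<ge>n + k. coeff f i = 0)"
  using g
proof (induction n arbitrary: g)
  case 0
  hence "g = 0" by (simp add: poly_eq_iff)
  thus ?case using linear_opD(4)[OF F] by (intro exI[of _ 0]) simp
next
  case (Suc n)
  obtain f where f: "\<forall>i\<ge>n + k + 1. coeff f i = 0" "\<forall>i\<ge>n + 1. coeff (F f) i = 0" "coeff (F f) n \<noteq> 0"
    using lead[of n] by blast
  define c where "c = coeff g n / coeff (F f) n"
  have "\<forall>i\<ge>n. coeff (g - cst c * F f) i = 0"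
  proof (intro allI impI)
    fix i assume "i \<ge> n"
    thus "coeff (g - cst c * F f) i = 0"
      using f(2,3) Suc.prems by (cases "i = n") (auto simp: c_def)
  qed
  from Suc.IH[OF this] obtain h where h: "F h = g - cst c * F f" "\<forall>i\<ge>n + k. coeff h i = 0" by blast
  have "F (h + cst c * f) = g" by (simp add: linear_opD[OF F] h(1))
  moreover have "\<forall>i\<ge>Suc n + k. coeff (h + cst c * f) i = 0" using h(2) f(1) by simp
  ultimately show ?case by blast
qed

section \<open>The calculus of the difference and mean operators\<close>

text \<open>
The leading coefficients of the images of \<open>x\<^sup>n\<close> under \<open>D\<close> and \<open>S\<close>. With \<open>\<alpha> = (r + 1/r)/2\<close> and
\<open>r\<^sup>2 = q \<noteq> 1\<close> they are \<open>(r\<^sup>n - r\<^sup>-\<^sup>n)/(r - r\<^sup>-\<^sup>1)\<close> and \<open>(r\<^sup>n + r\<^sup>-\<^sup>n)/2\<close>; they are \<open>n\<close> and 1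
 for \<open>\<alpha> = 1\<close>.
\<close>

fun lead_D :: "real \<Rightarrow> nat \<Rightarrow> real" and lead_S :: "real \<Rightarrow> nat \<Rightarrow> real" where
  "lead_D \<alpha> 0 = 0"
| "lead_D \<alpha> (Suc n) = lead_S \<alpha> n + \<alpha> * lead_D \<alpha> n"
| "lead_S \<alpha> 0 = 1"
| "lead_S \<alpha> (Suc n) = (\<alpha>\<^sup>2 - 1) * lead_D \<alpha> n + \<alpha> * lead_S \<alpha> n"

lemma lead_D_S_pos:
  assumes "\<alpha> \<ge> 1"
  shows "lead_D \<alpha> n \<ge> 0 \<and> lead_S \<alpha> n > 0"
proof (induction n)
  case (Suc n)
  have "\<alpha>\<^sup>2 - 1 \<ge> 0" using assms by simp
  thus ?case using Suc assms by (auto intro!: add_nonneg_pos)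
qed simp

lemma lead_D_pos: "\<alpha> \<ge> 1 \<Longrightarrow> lead_D \<alpha> (Suc n) > 0"
  using lead_D_S_pos[of \<alpha> n] by (auto intro!: add_pos_nonneg)

text \<open>
A Pell equation. It excludes cancellation of leading terms in \<open>V D + S\<close> when \<open>V\<^sup>2 = U\<close>.
\<close>

lemma lead_D_S_pell: "(lead_S \<alpha> n)\<^sup>2 - (\<alpha>\<^sup>2 - 1) * (lead_D \<alpha> n)\<^sup>2 = 1"
proof (induction n)
  case (Suc n)
  have "(lead_S \<alpha> (Suc n))\<^sup>2 - (\<alpha>\<^sup>2 - 1) * (lead_D \<alpha> (Suc n))\<^sup>2
      = (lead_S \<alpha> n)\<^sup>2 - (\<alpha>\<^sup>2 - 1) * (lead_D \<alpha> n)\<^sup>2"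
    by (simp add: algebra_simps power2_eq_square)
  thus ?case using Suc by simp
qed simp

text \<open>
All that is used of the lattice. The coefficients of \<open>U\<close> are not independent of \<open>p\<close>: this
relation is what makes the rules for \<open>D S\<close> and \<open>S S\<close> below close up.
\<close>

locale lattice_calculus =
  fixes D S :: "real poly \<Rightarrow> real poly" and \<alpha> \<beta> \<delta> :: real
  assumes alpha: "\<alpha> \<ge> 1"
    and linD: "linear_op D" and linS: "linear_op S"
    and D_one: "D 1 = 0" and S_one: "S 1 = 1"
    and D_var0: "D (var * f) = S f + (cst \<alpha> * var + cst \<beta>) * D f"
    and S_var0: "S (var * f) = ((cst \<alpha> ^ 2 - 1) * var ^ 2 + 2 * cst \<beta> * (cst \<alpha> + 1) * var + cst \<delta>) * D f
      + (cst \<alpha> * var + cst \<beta>) * S f"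
begin

abbreviation "A \<equiv> cst \<alpha>"
abbreviation "B \<equiv> cst \<beta>"

text \<open>
In terms of the lattice, \<open>p\<close> and \<open>w1\<close> are the mean and the product of \<open>x(s + 1/2)\<close> and \<open>x(s - 1/2)\<close>, \<open>X\<close>
and \<open>W\<close> are the mean and the product of \<open>x(s + 1)\<close> and \<open>x(s - 1)\<close>, and \<open>U\<close> is the square of
\<open>(x(s + 1/2) - x(s - 1/2))/2\<close>.
\<close>

definition p where "p = A * var + B"
definition U where "U = (A ^ 2 - 1) * var ^ 2 + 2 * B * (A + 1) * var + cst \<delta>"
definition U1 where "U1 = (A ^ 2 - 1) * var + B * (A + 1)"
definition X where "X = (2 * A ^ 2 - 1) * var + 2 * B * (A + 1)"
definition W where "W = X ^ 2 - 4 * A ^ 2 * U"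
definition w1 where "w1 = p ^ 2 - U"

lemmas Dl = linear_opD[OF linD] and Sl = linear_opD[OF linS]

lemma D_var: "D (var * f) = S f + p * D f" by (simp add: D_var0 p_def)
lemma S_var: "S (var * f) = U * D f + p * S f" by (simp add: S_var0 p_def U_def)

lemma D_cst: "D (cst c) = 0" and S_cst: "S (cst c) = cst c"
  using Dl(2)[of c 1] Sl(2)[of c 1] D_one S_one by simp_all

lemma D_mult: "D (f * g) = S f * D g + D f * S g"
  and S_mult: "S (f * g) = U * D f * D g + S f * S g"
proof -
  have "D (f * g) = S f * D g + D f * S g \<and> S (f * g) = U * D f * D g + S f * S g"
  proof (induction f rule: poly_var_induct)
    case (var_mult f)
    note IH = var_mult
    show ?case by (simp only: mult.assoc[of var] D_var S_var IH) (simp add: algebra_simps)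
  qed (simp_all add: Dl Sl D_cst S_cst algebra_simps Dl(2)[of _ g, simplified mult.commute[of _ g]] Sl(2)[of _ g, simplified mult.commute[of _ g]])
  thus "D (f * g) = S f * D g + D f * S g" "S (f * g) = U * D f * D g + S f * S g" by simp_all
qed

lemma D_varp: "D var = 1" and S_varp: "S var = p"
  using D_var[of 1] S_var[of 1] by (simp_all add: D_one S_one)

lemma D_p: "D p = A" and S_p: "S p = A * p + B"
  by (simp_all add: p_def Dl Sl D_cst S_cst D_varp S_varp)

lemma S_varsq: "S (var ^ 2) = U + p ^ 2" and D_varsq: "D (var ^ 2) = 2 * p"
  by (simp_all add: power2_eq_square D_mult S_mult D_varp S_varp)

lemma D_S: "D (S f) = A * S (D f) + U1 * D (D f)"
  and S_S: "S (S f) = U1 * S (D f) + A * U * D (D f) + f"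
proof -
  have e: "A ^ 2 - 1 = cst (\<alpha>^2 - 1)" "2 * B * (A + 1) = cst (2 * \<beta> * (\<alpha> + 1))" by (simp_all add: cst_hom)
  have DU: "D U = (A ^ 2 - 1) * (2 * p) + 2 * B * (A + 1)"
    unfolding U_def e Dl D_varp D_varsq D_cst by simp
  have SU: "S U = (A ^ 2 - 1) * (U + p ^ 2) + 2 * B * (A + 1) * p + cst \<delta>"
    unfolding U_def[folded e] unfolding e Sl S_varp S_varsq S_cst unfolding U_def e by simp
  have "D (S f) = A * S (D f) + U1 * D (D f) \<and> S (S f) = U1 * S (D f) + A * U * D (D f) + f"
  proof (induction f rule: poly_var_induct)
    case (var_mult f)
    note IH = var_mult[THEN conjunct1] var_mult[THEN conjunct2]
    show ?case
      unfolding D_var S_var Dl Sl D_mult[of p] D_mult[of U] S_mult[of p] S_mult[of U] IH D_p S_p DU SU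
      unfolding p_def U1_def U_def
      by (simp add: algebra_simps power2_eq_square)
  qed (simp_all add: Dl Sl D_cst S_cst algebra_simps)
  thus "D (S f) = A * S (D f) + U1 * D (D f)" "S (S f) = U1 * S (D f) + A * U * D (D f) + f" by simp_all
qed

lemma DD_var: "D (D (var * f)) = 2 * A * S (D f) + X * D (D f)"
  unfolding D_var Dl D_mult[of p] D_S D_p S_p unfolding U1_def X_def p_def
  by (simp add: algebra_simps power2_eq_square)

lemma SD_var: "S (D (var * f)) = f + 2 * A * U * D (D f) + X * S (D f)"
  unfolding D_var Sl S_mult[of p] S_S D_p S_p unfolding U1_def X_def p_def
  by (simp add: algebra_simps power2_eq_square)

text \<open>
Such an operator combines values at \<open>s + 1/2\<close> and \<open>s - 1/2\<close>, and multiplication by \<open>x\<close> of its argument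
acts on the two values by the roots of \<open>t\<^sup>2 - 2 p t + w1\<close>. This recursion determines the operator from
its values on 1 and \<open>x\<close>.
\<close>

lemma first_order_quad:
  assumes "\<And>f. Op f = \<phi> * D f + \<psi> * S f"
  shows "Op (var * (var * f)) = 2 * p * Op (var * f) - w1 * Op f"
  unfolding assms D_var S_var w1_def by (simp add: algebra_simps power2_eq_square)

text \<open>
The analogue with full steps. The values at \<open>s + 1\<close> and \<open>s - 1\<close> are annihilated by \<open>t\<^sup>2 - 2 X t + W\<close>,
and the multiple of \<open>f\<close> comes from the value at \<open>s\<close> itself.
\<close>

lemma second_order_quad:
  assumes "\<And>f. T f = \<phi> * D (D f) + \<psi> * S (D f)"
  shows "T (var * (var * f)) = 2 * X * T (var * f) - W * T f + (\<psi> * (var - X) + 2 * A * \<phi>) * f"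
  unfolding assms DD_var SD_var W_def by (simp add: algebra_simps power2_eq_square)

text \<open>
The statement is about \<open>x D f\<close> instead of \<open>D f\<close> so that both operators preserve the degree bound
and the induction needs no case distinction at degree 0.
\<close>

lemma leading_coeffs:
  assumes "\<forall>i>n. coeff f i = 0"
  shows "(\<forall>i>n. coeff (var * D f) i = 0) \<and> coeff (var * D f) n = lead_D \<alpha> n * coeff f n \<and>
    (\<forall>i>n. coeff (S f) i = 0) \<and> coeff (S f) n = lead_S \<alpha> n * coeff f n"
  using assms
proof (induction n arbitrary: f)
  case 0
  hence "f = cst (coeff f 0)" by (auto simp: poly_eq_iff cst_def coeff_pCons split: nat.splits)
  then obtain c where "f = cst c" by blast
  moreover have "coeff (cst c) i = (if i = 0 then c else 0)" for i
    by (simp add: cst_def coeff_pCons split: nat.splits)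
  ultimately show ?case by (auto simp: D_cst S_cst)
next
  case (Suc n)
  obtain c g where f: "f = pCons c g" by (cases f) auto
  have g: "\<forall>i>n. coeff g i = 0" using Suc.prems unfolding f by auto
  note IH = Suc.IH[OF g]
  define E where "E = var * D g"
  have Dg: "coeff (D g) i = coeff E (Suc i)" for i by (simp add: E_def coeff_var_mult)
  have E: "\<forall>i>n. coeff E i = 0" "coeff E n = lead_D \<alpha> n * coeff g n"
    and Sg: "\<forall>i>n. coeff (S g) i = 0" "coeff (S g) n = lead_S \<alpha> n * coeff g n"
    using IH by (auto simp: E_def)
  have 1: "var * D f = var * S g + (A * (var * E) + B * E)"
    unfolding f pCons_var Dl D_cst D_var p_def E_def by (simp add: algebra_simps)
  have e: "(A ^ 2 - 1) = cst (\<alpha>^2 - 1)" "2 * B * (A + 1) = cst (2 * \<beta> * (\<alpha> + 1))" by (simp_all add: cst_hom)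
  have "S f = cst c + ((A ^ 2 - 1) * (var * E) + 2 * B * (A + 1) * E + cst \<delta> * D g) + (A * (var * S g) + B * S g)"
    unfolding f pCons_var Sl S_cst S_var p_def E_def U_def by (simp add: algebra_simps power2_eq_square)
  hence 2: "S f = cst c + (cst (\<alpha>^2 - 1) * (var * E) + cst (2 * \<beta> * (\<alpha> + 1)) * E + cst \<delta> * D g) + (A * (var * S g) + B * S g)"
    by (simp only: e)
  have c: "coeff (cst c) (Suc i) = 0" for i by (simp add: cst_def)
  have b: "coeff (var * D f) (Suc i) = coeff (S g) i + \<alpha> * coeff E i + \<beta> * coeff E (Suc i)"
    "coeff (S f) (Suc i) = (\<alpha>^2 - 1) * coeff E i + 2 * \<beta> * (\<alpha> + 1) * coeff E (Suc i)
      + \<delta> * coeff E (Suc (Suc i)) + \<alpha> * coeff (S g) i + \<beta> * coeff (S g) (Suc i)" for i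
    unfolding 1 2 by (simp_all add: coeff_var_mult c Dg)
  have "coeff (var * D f) i = 0" "coeff (S f) i = 0" if "i > Suc n" for i
  proof -
    obtain j where "i = Suc j" "j > n" using \<open>i > Suc n\<close> by (auto simp: Suc_less_eq2)
    thus "coeff (var * D f) i = 0" "coeff (S f) i = 0" using E(1) Sg(1) by (simp_all add: b)
  qed
  moreover have "coeff (var * D f) (Suc n) = lead_D \<alpha> (Suc n) * coeff f (Suc n)"
    "coeff (S f) (Suc n) = lead_S \<alpha> (Suc n) * coeff f (Suc n)"
    unfolding b using E Sg by (simp_all add: f algebra_simps)
  ultimately show ?case by blast
qed

lemma coeff_D: "degree f \<le> Suc n \<Longrightarrow> coeff (D f) n = lead_D \<alpha> (Suc n) * coeff f (Suc n)"
  using leading_coeffs[of "Suc n" f] by (auto simp: coeff_eq_0 coeff_var_mult)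

lemma coeff_S: "degree f \<le> n \<Longrightarrow> coeff (S f) n = lead_S \<alpha> n * coeff f n"
  using leading_coeffs[of n f] by (auto simp: coeff_eq_0)

lemma degree_S_le: "degree (S f) \<le> degree f"
  by (rule degree_le) (use leading_coeffs[of "degree f" f] in \<open>auto simp: coeff_eq_0\<close>)

lemma degree_D_le: "degree (D f) \<le> degree f - 1"
proof (rule degree_le, intro allI impI)
  fix i assume "degree f - 1 < i"
  hence "degree f < Suc i" by simp
  with leading_coeffs[of "degree f" f] have "coeff (var * D f) (Suc i) = 0" by (auto simp: coeff_eq_0)
  thus "coeff (D f) i = 0" by (simp add: coeff_var_mult)
qed

lemma degree_D: "degree (D f) = degree f - 1"
proof (cases "degree f")
  case 0
  thus ?thesis using degree_D_le[of f] by simp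
next
  case (Suc n)
  hence "coeff (D f) n \<noteq> 0" using coeff_D[of f n] lead_D_pos[OF alpha, of n] leading_coeff_0_iff[of f] by auto
  thus ?thesis using degree_D_le[of f] le_degree[of "D f" n] Suc by simp
qed

lemma D_eq_0: "D f = 0 \<Longrightarrow> degree f = 0"
proof (rule ccontr)
  assume z: "D f = 0" and "degree f \<noteq> 0"
  then obtain n where n: "degree f = Suc n" by (cases "degree f") auto
  hence "coeff (D f) n \<noteq> 0" using coeff_D[of f n] lead_D_pos[OF alpha, of n] leading_coeff_0_iff[of f] by auto
  thus False using z by simp
qed

lemma D_surj: "\<exists>f. D f = g \<and> degree f \<le> degree g + 1"
proof -
  have "\<exists>f. (\<forall>i\<ge>n + 1 + 1. coeff f i = 0) \<and> (\<forall>i\<ge>n + 1. coeff (D f) i = 0) \<and> coeff (D f) n \<noteq> 0" for n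
  proof (intro exI conjI)
    let ?f = "monom (1::real) (Suc n)"
    have d: "degree ?f = Suc n" by (simp add: degree_monom_eq)
    show "\<forall>i\<ge>n + 1 + 1. coeff ?f i = 0" using d by simp
    show "\<forall>i\<ge>n + 1. coeff (D ?f) i = 0" using degree_D[of ?f] d by (auto intro!: coeff_eq_0)
    show "coeff (D ?f) n \<noteq> 0" using coeff_D[of ?f n] lead_D_pos[OF alpha, of n] d by simp
  qed
  from linear_op_surj[OF linD this, of "Suc (degree g)" g]
  obtain f where f: "D f = g" "\<forall>i\<ge>degree g + 2. coeff f i = 0" by (auto simp: coeff_eq_0)
  have "degree f \<le> degree g + 1" by (rule degree_le) (use f(2) in auto)
  thus ?thesis using f(1) by blast
qed

end

section \<open>Orthogonal expansions\<close>

definition linear_functional :: "(real poly \<Rightarrow> real) \<Rightarrow> bool" where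
  "linear_functional F \<longleftrightarrow> (\<forall>f g. F (f + g) = F f + F g) \<and> (\<forall>c f. F (cst c * f) = c * F f)"

lemma linear_functionalD:
  assumes "linear_functional F"
  shows "F (f + g) = F f + F g" "F (cst c * f) = c * F f" "F (f - g) = F f - F g"
    "F 0 = 0" "F (- f) = - F f"
proof -
  show add: "F (f + g) = F f + F g" for f g using assms by (simp add: linear_functional_def)
  show sc: "F (cst c * f) = c * F f" for c f using assms by (simp add: linear_functional_def)
  show zero: "F 0 = 0" using sc[of 0 0] by simp
  show neg: "F (- f) = - F f" for f using sc[of "-1" f] by (simp add: cst_hom)
  show "F (f - g) = F f - F g" using add[of f "- g"] neg[of g] by simp
qed

lemma linear_functional_sum:
  assumes "linear_functional F"
  shows "F (\<Sum>i\<in>I. cst (c i) * f i) = (\<Sum>i\<in>I. c i * F (f i))"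
  by (induction I rule: infinite_finite_induct) (simp_all add: linear_functionalD[OF assms])

lemma graded_expansion:
  assumes degree_P: "\<And>n. degree (P n) = n" and P_nz: "\<And>n. P n \<noteq> 0"
    and "\<forall>i\<ge>n. coeff f i = 0"
  shows "\<exists>c. f = (\<Sum>m<n. cst (c m) * P m)"
  using assms(3)
proof (induction n arbitrary: f)
  case 0
  thus ?case by (auto simp: poly_eq_iff)
next
  case (Suc n)
  have lead_P: "coeff (P n) n \<noteq> 0"
    using P_nz[of n] degree_P[of n] leading_coeff_0_iff[of "P n"] by simp
  define a where "a = coeff f n / coeff (P n) n"
  have "\<forall>i\<ge>n. coeff (f - cst a * P n) i = 0"
  proof (intro allI impI)
    fix i assume "i \<ge> n"
    thus "coeff (f - cst a * P n) i = 0"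
      using lead_P Suc.prems degree_P[of n] coeff_eq_0[of "P n" i]
      by (cases "i = n") (auto simp: a_def)
  qed
  from Suc.IH[OF this] obtain c where c: "f - cst a * P n = (\<Sum>m<n. cst (c m) * P m)" by blast
  have "f = (\<Sum>m<Suc n. cst ((c(n := a)) m) * P m)"
    using c by (simp add: algebra_simps)
  thus ?case by blast
qed

locale orthogonal_basis =
  fixes L :: "real poly \<Rightarrow> real" and P :: "nat \<Rightarrow> real poly" and d :: "nat \<Rightarrow> real"
  assumes linL: "linear_functional L"
    and degree_P: "degree (P n) = n"
    and orth: "L (P m * P n) = (if m = n then d n else 0)"
    and d_nz: "d n \<noteq> 0"
begin

lemmas Ll = linear_functionalD[OF linL]

lemma P_nz: "P n \<noteq> 0"
  using orth[of n n] d_nz[of n] by (auto simp: Ll)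

lemma lead_P: "coeff (P n) n \<noteq> 0"
  using P_nz[of n] degree_P[of n] leading_coeff_0_iff[of "P n"] by simp

lemma linear_functional_L_mult: "linear_functional (\<lambda>f. L (f * g))"
  by (simp add: linear_functional_def Ll distrib_right mult.assoc)

lemma linear_functional_L_mult': "linear_functional (\<lambda>f. L (g * f))"
  using linear_functional_L_mult[of g] by (simp add: mult.commute)

lemma expansion:
  assumes "\<forall>i\<ge>n. coeff f i = 0"
  shows "f = (\<Sum>m<n. cst (L (f * P m) / d m) * P m)"
proof -
  obtain c where c: "f = (\<Sum>m<n. cst (c m) * P m)" using graded_expansion[of P, OF degree_P P_nz assms] by blast
  have "L (f * P m) = c m * d m" if "m < n" for m
  proof -
    have "L (f * P m) = (\<Sum>j<n. c j * L (P j * P m))"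
      unfolding c by (rule linear_functional_sum[OF linear_functional_L_mult])
    also have "\<dots> = (\<Sum>j<n. if j = m then c m * d m else 0)" by (intro sum.cong) (simp_all add: orth)
    finally show ?thesis using that by simp
  qed
  hence "c m = L (f * P m) / d m" if "m < n" for m using that d_nz[of m] by simp
  hence "(\<Sum>m<n. cst (L (f * P m) / d m) * P m) = (\<Sum>m<n. cst (c m) * P m)"
    by (intro sum.cong) simp_all
  thus ?thesis using c by argo
qed

lemma fourier:
  assumes "linear_functional F" "degree f < n"
  shows "F f = (\<Sum>m<n. L (f * P m) / d m * F (P m))"
proof -
  have "f = (\<Sum>m<n. cst (L (f * P m) / d m) * P m)"
    by (rule expansion) (use assms(2) in \<open>auto intro: coeff_eq_0\<close>)
  hence "F f = F (\<Sum>m<n. cst (L (f * P m) / d m) * P m)" by (rule arg_cong)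
  also have "\<dots> = (\<Sum>m<n. L (f * P m) / d m * F (P m))" by (rule linear_functional_sum[OF assms(1)])
  finally show ?thesis .
qed

text \<open>
The form in which expansions are used: bandedness makes all terms but one vanish, because either the
coefficient of \<open>f\<close> or the value on the basis polynomial is 0.
\<close>

lemma fourier_single:
  assumes "linear_functional F" "\<And>m. m \<noteq> n \<Longrightarrow> L (f * P m) = 0 \<or> F (P m) = 0"
  shows "F f = L (f * P n) / d n * F (P n)"
proof -
  have "F f = (\<Sum>m<Suc (degree f + n). L (f * P m) / d m * F (P m))"
    by (rule fourier[OF assms(1)]) simp
  also have "\<dots> = (\<Sum>m<Suc (degree f + n). if m = n then L (f * P n) / d n * F (P n) else 0)"
    by (intro sum.cong) (use assms(2) in auto)
  also have "\<dots> = L (f * P n) / d n * F (P n)" by simp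
  finally show ?thesis .
qed

lemma fourier_vanish:
  assumes "linear_functional F" "\<And>m. L (f * P m) = 0 \<or> F (P m) = 0"
  shows "F f = 0"
  using fourier_single[OF assms(1), of 0 f] assms(2) by fastforce

lemma orth_low:
  assumes "degree f < n"
  shows "L (f * P n) = 0"
  using fourier[OF linear_functional_L_mult assms, of "P n"] by (simp add: orth)

lemma orth_low':
  assumes "degree f < n"
  shows "L (P n * f) = 0"
  using orth_low[OF assms] by (simp add: mult.commute)

lemma orth_lead:
  assumes "degree f \<le> n"
  shows "L (f * P n) = coeff f n / coeff (P n) n * d n"
proof -
  define a where "a = coeff f n / coeff (P n) n"
  have "L ((f - cst a * P n) * P n) = 0"
  proof (cases "n = 0")
    case True
    have "f - cst a * P n = 0"
    proof (rule poly_eqI)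
      fix i show "coeff (f - cst a * P n) i = coeff 0 i"
        using assms True degree_P[of n] lead_P[of n] coeff_eq_0[of f i] coeff_eq_0[of "P n" i]
        by (cases "i = 0") (auto simp: a_def)
    qed
    thus ?thesis by (simp add: Ll)
  next
    case False
    have "degree (f - cst a * P n) \<le> n - 1"
    proof (rule degree_le, intro allI impI)
      fix i assume "n - 1 < i"
      thus "coeff (f - cst a * P n) i = 0"
        using assms False degree_P[of n] lead_P[of n] coeff_eq_0[of f i] coeff_eq_0[of "P n" i]
        by (cases "i = n") (auto simp: a_def)
    qed
    thus ?thesis using False by (intro orth_low) simp
  qed
  thus ?thesis by (simp add: left_diff_distrib Ll mult.assoc orth a_def)
qed

lemma orth_lead_nz: "degree f = n \<Longrightarrow> f \<noteq> 0 \<Longrightarrow> L (f * P n) \<noteq> 0"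
  using orth_lead[of f n] lead_P[of n] d_nz[of n] leading_coeff_0_iff[of f] by simp

lemma nondegenerate:
  assumes "\<And>m. L (f * P m) = 0"
  shows "f = 0"
proof (rule ccontr)
  assume "f \<noteq> 0"
  thus False using orth_lead_nz[of f "degree f"] assms by simp
qed

text \<open>
Among the polynomials of degree at most \<open>n\<close>, orthogonality to all lower degrees characterises the
multiples of \<open>P n\<close>; operators are shown to be diagonal in this way.
\<close>

lemma eq_mult_P:
  assumes "degree f \<le> n" "\<And>m. m < n \<Longrightarrow> L (f * P m) = 0"
  shows "f = cst (L (f * P n) / d n) * P n"
proof -
  have "f - cst (L (f * P n) / d n) * P n = 0"
  proof (rule nondegenerate)
    fix m
    have "L (f * P m) = 0" if "m > n" by (rule orth_low) (use assms(1) that in simp)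
    moreover have "n \<noteq> m \<Longrightarrow> L (P n * P m) = 0" by (simp add: orth)
    ultimately show "L ((f - cst (L (f * P n) / d n) * P n) * P m) = 0"
      using assms(2)[of m] d_nz[of n] by (cases m n rule: linorder_cases) (simp_all add: left_diff_distrib Ll mult.assoc orth)
  qed
  thus ?thesis by simp
qed

end

section \<open>Coefficients with respect to the differences of the orthogonal polynomials\<close>

locale lattice_polynomials = lattice_calculus + orthogonal_basis
begin

abbreviation "R n \<equiv> D (D (P n))"

definition antidifference where "antidifference g = (SOME f. D f = g \<and> degree f \<le> degree g + 1)"

lemma D_antidifference: "D (antidifference g) = g" and degree_antidifference: "degree (antidifference g) \<le> degree g + 1"
  using someI_ex[OF D_surj[of g]] by (simp_all add: antidifference_def)

lemma L_P_cong_D: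
  assumes "D f = D g" "m \<ge> 1"
  shows "L (f * P m) = L (g * P m)"
proof -
  have "degree (f - g) = 0" by (rule D_eq_0) (use assms(1) in \<open>simp add: Dl\<close>)
  hence "L ((f - g) * P m) = 0" using assms(2) by (intro orth_low) simp
  thus ?thesis by (simp add: left_diff_distrib Ll)
qed

text \<open>
Up to the factor \<open>d m\<close>, this is the coefficient of \<open>D (P m)\<close> in the expansion of \<open>g\<close>. The choice
of the antidifference is irrelevant for \<open>m \<ge> 1\<close>, since constants are orthogonal to \<open>P m\<close>.
\<close>

definition D_coeff where "D_coeff m g = L (antidifference g * P m)"

lemma D_coeff_D: "m \<ge> 1 \<Longrightarrow> D_coeff m (D f) = L (f * P m)"
  unfolding D_coeff_def by (rule L_P_cong_D) (simp_all add: D_antidifference)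

lemma linear_D_coeff: "m \<ge> 1 \<Longrightarrow> linear_functional (D_coeff m)"
  unfolding linear_functional_def
proof (intro conjI allI)
  fix f g c assume m: "m \<ge> 1"
  have "D_coeff m (D (antidifference f + antidifference g)) = D_coeff m f + D_coeff m g"
    unfolding D_coeff_D[OF m] by (simp add: distrib_right Ll D_coeff_def)
  thus "D_coeff m (f + g) = D_coeff m f + D_coeff m g" by (simp add: Dl D_antidifference)
  have "D_coeff m (D (cst c * antidifference f)) = c * D_coeff m f"
    unfolding D_coeff_D[OF m] by (simp add: Ll D_coeff_def mult.assoc)
  thus "D_coeff m (cst c * f) = c * D_coeff m f" by (simp add: Dl D_antidifference)
qed

definition var_D_coeff where "var_D_coeff m f = D_coeff m (var * D f)"

lemma linear_var_D_coeff: "m \<ge> 1 \<Longrightarrow> linear_functional (var_D_coeff m)"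
  using linear_functionalD[OF linear_D_coeff[of m]]
  by (simp add: linear_functional_def var_D_coeff_def Dl distrib_left mult.left_commute[of var])

lemma var_D_coeff_0: "m \<ge> 1 \<Longrightarrow> var_D_coeff m (P 0) = 0"
proof -
  assume m: "m \<ge> 1"
  have "D (P 0) = 0"
  proof -
    obtain c where "P 0 = [:c:]" using degree_P[of 0] degree_eq_zeroE by blast
    thus ?thesis using D_cst[of c] by (simp add: cst_def)
  qed
  thus "var_D_coeff m (P 0) = 0" using linear_functionalD(4)[OF linear_D_coeff[OF m]] by (simp add: var_D_coeff_def)
qed

lemma var_D_coeff_antidifference: "m \<ge> 1 \<Longrightarrow> D y = var * D f \<Longrightarrow> L (y * P m) = var_D_coeff m f"
  unfolding var_D_coeff_def using D_coeff_D[of m y] by simp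

text \<open>
The recursion for \<open>D (x\<^sup>2 h)\<close>, read off at the coefficient of \<open>D (P m)\<close>. Here \<open>y\<close> lifts \<open>x D h\<close>, so that
\<open>x\<^sup>2 D h = x D y\<close> is again of the form covered by \<open>var_D_coeff\<close>.
\<close>

lemma var_D_coeff_relation:
  assumes "m \<ge> 1" "D y = var * D h"
  shows "L (var * (var * h) * P m) - 2 * \<alpha> * var_D_coeff m (var * h) - 2 * \<beta> * L (var * h * P m)
    + var_D_coeff m y - 2 * \<beta> * var_D_coeff m h + (\<beta>\<^sup>2 - \<delta>) * L (h * P m) = 0"
proof -
  have w1: "w1 = var ^ 2 - 2 * B * var + (B ^ 2 - cst \<delta>)"
    unfolding w1_def p_def U_def by (simp add: algebra_simps power2_eq_square)
  have q: "D (var * (var * h)) = 2 * p * D (var * h) - w1 * D h"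
    by (rule first_order_quad[of D 1 0]) simp
  have "D (var * (var * h)) - cst (2 * \<alpha>) * (var * D (var * h)) - cst (2 * \<beta>) * D (var * h)
     + var * D y - cst (2 * \<beta>) * (var * D h) + cst (\<beta>\<^sup>2 - \<delta>) * D h = 0"
    unfolding q assms(2) w1 p_def by (simp add: cst_hom algebra_simps power2_eq_square)
  from arg_cong[OF this, of "D_coeff m"] show ?thesis
    by (simp only: linear_functionalD[OF linear_D_coeff[OF assms(1)]] D_coeff_D[OF assms(1)] var_D_coeff_def)
qed

end

section \<open>From orthogonal second differences to a difference equation\<close>

locale D2_orthogonal = lattice_polynomials +
  fixes \<pi> :: "real poly"
  assumes D2_orth: "m \<ge> 2 \<Longrightarrow> n \<ge> 2 \<Longrightarrow> L (R m * R n * \<pi>) = 0 \<longleftrightarrow> m \<noteq> n"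
begin

lemma R_low: "n < 2 \<Longrightarrow> R n = 0"
proof -
  assume "n < 2"
  hence "degree (D (P n)) = 0" using degree_D[of "P n"] degree_P[of n] by simp
  then obtain c where "D (P n) = [:c:]" by (rule degree_eq_zeroE)
  thus ?thesis using D_cst[of c] by (simp add: cst_def)
qed

definition norm_ratio where "norm_ratio m = L (R m * R m * \<pi>) / d m"

lemma norm_ratio_nz: "m \<ge> 2 \<Longrightarrow> norm_ratio m \<noteq> 0"
  using D2_orth[of m m] d_nz[of m] by (simp add: norm_ratio_def)

text \<open>
\<open>D D\<close> sends one orthogonal system to another, so its adjoint sends \<open>R m\<close> to a multiple of \<open>P m\<close>.
\<close>

lemma pairing_R:
  assumes "m \<ge> 2"
  shows "L (R m * D (D f) * \<pi>) = norm_ratio m * L (f * P m)"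
proof -
  have lin: "linear_functional (\<lambda>f. L (R m * D (D f) * \<pi>))"
    by (simp add: linear_functional_def Dl Ll distrib_left distrib_right mult.assoc mult.left_commute[of _ "cst c" for c])
  have "L (R m * D (D f) * \<pi>) = L (f * P m) / d m * L (R m * R m * \<pi>)"
    by (rule fourier_single[OF lin])
      (use D2_orth[of m] R_low assms in \<open>metis (no_types) Ll(4) mult_zero_left mult_zero_right not_less\<close>)
  thus ?thesis by (simp add: norm_ratio_def)
qed

lemma var_R_orth:
  assumes "n + 1 < m"
  shows "L (var * R m * R n * \<pi>) = 0"
proof (cases "n < 2")
  case True
  thus ?thesis by (simp add: R_low Ll)
next
  case False
  \<comment> \<open>Lifting \<open>x R n\<close> through \<open>D D\<close> gives degree at most \<open>n + 1\<close>, which is below \<open>m\<close>.\<close>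
  define g where "g = antidifference (antidifference (var * R n))"
  have g: "D (D g) = var * R n" "degree g \<le> degree (var * R n) + 2"
    using degree_antidifference[of "antidifference (var * R n)"] degree_antidifference[of "var * R n"] by (simp_all add: g_def D_antidifference)
  have "degree (var * R n) \<le> n - 1"
    using degree_mult_le[of var "R n"] degree_D[of "D (P n)"] degree_D[of "P n"] degree_P[of n] False by simp
  hence "degree g < m" using g(2) assms False by simp
  hence "L (R m * D (D g) * \<pi>) = 0" using pairing_R[of m g] assms False orth_low by simp
  thus ?thesis by (simp add: g(1) ac_simps)
qed

text \<open>
The case \<open>m = 1\<close> is missing because the proof applies \<open>D\<close> to the expansion of \<open>x D (P n)\<close>, and this
removes the constant \<open>D (P 1)\<close>.
\<close>

lemma var_D_coeff_banded:
  assumes "m \<ge> 2" "m + 1 < n \<or> n + 1 < m"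
  shows "var_D_coeff m (P n) = 0"
proof -
  obtain y where y: "D y = var * D (P n)" using D_surj by blast
  have "D (D (var * P n)) = 2 * A * S (D (P n)) + X * R n" by (rule DD_var)
  moreover have "D (D y) = S (D (P n)) + p * R n" by (simp add: y D_var)
  \<comment> \<open>Eliminating \<open>S (D (P n))\<close> leaves a factor of degree 1, as \<open>2 A p - X = x - 2 B\<close>.\<close>
  ultimately have "2 * A * D (D y) = D (D (var * P n)) + (var - 2 * B) * R n"
    unfolding X_def p_def by (simp add: algebra_simps power2_eq_square)
  hence "cst (2 * \<alpha>) * (R m * D (D y) * \<pi>)
      = R m * D (D (var * P n)) * \<pi> + var * R m * R n * \<pi> - cst (2 * \<beta>) * (R m * R n * \<pi>)"
    by (simp add: cst_hom) algebra
  from arg_cong[OF this, of L]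
  have "2 * \<alpha> * L (R m * D (D y) * \<pi>)
      = L (R m * D (D (var * P n)) * \<pi>) + L (var * R m * R n * \<pi>) - 2 * \<beta> * L (R m * R n * \<pi>)"
    by (simp only: Ll)
  moreover have "L (R m * R n * \<pi>) = 0"
    using D2_orth[of m n] assms R_low[of n] by (cases "n < 2") (auto simp: Ll)
  moreover have "L (var * R m * R n * \<pi>) = 0"
    using assms(2) var_R_orth[of n m] var_R_orth[of m n] by (auto simp: ac_simps)
  moreover have "L (var * P n * P m) = 0"
    using assms(2)
  proof
    assume "n + 1 < m"
    thus ?thesis using degree_mult_le[of var "P n"] degree_P[of n] by (intro orth_low) simp
  next
    assume "m + 1 < n"
    hence "L (var * P m * P n) = 0" using degree_mult_le[of var "P m"] degree_P[of m] by (intro orth_low) simp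
    thus ?thesis by (simp add: ac_simps)
  qed
  ultimately have "norm_ratio m * L (y * P m) = 0"
    using pairing_R[OF assms(1), of y] pairing_R[OF assms(1), of "var * P n"] alpha by simp
  thus ?thesis using norm_ratio_nz[OF assms(1)] var_D_coeff_antidifference[OF _ y, of m] assms(1) by simp
qed

lemma var_orth: "m + 1 < n \<Longrightarrow> L (var * P n * P m) = 0"
  using orth_low[of "var * P m" n] degree_mult_le[of var "P m"] degree_P[of m] by (simp add: ac_simps)

lemma var_var_orth: "m + 2 < n \<Longrightarrow> L (var * (var * P n) * P m) = 0"
  using orth_low[of "var * var * P m" n] degree_mult_le[of "var * var" "P m"] degree_mult_le[of var var] degree_P[of m]
  by (simp add: ac_simps)

lemma var_var_lead: "L (var * (var * P (m + 2)) * P m) \<noteq> 0"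
proof -
  have nz: "var * var * P m \<noteq> 0" using P_nz[of m] by (simp add: var_def)
  hence "degree (var * var * P m) = m + 2" by (simp add: degree_mult_eq degree_P)
  from orth_lead_nz[OF this nz] show ?thesis by (simp add: ac_simps)
qed

lemma var_D_coeff_2_1: "var_D_coeff 2 (P 1) \<noteq> 0"
proof -
  obtain y where y: "D y = var * D (P 1)" using D_surj by blast
  have "D (P 1) \<noteq> 0" using D_eq_0[of "P 1"] degree_P[of 1] by auto
  hence "degree (D y) = 1" "D y \<noteq> 0"
    unfolding y using degree_D[of "P 1"] degree_P[of 1] by (auto simp: degree_mult_eq var_def)
  hence "degree y = 2" "y \<noteq> 0" using degree_D[of y] by (auto simp: Dl)
  hence "L (y * P 2) \<noteq> 0" by (rule orth_lead_nz)
  thus ?thesis using var_D_coeff_antidifference[OF _ y, of 2] by simp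
qed

text \<open>
If \<open>x D (P n)\<close> contained the constant \<open>D (P 1)\<close>, then \<open>x\<^sup>2 D (P n)\<close> would contain \<open>x D (P 1)\<close> and hence
\<open>D (P 2)\<close>. For \<open>n \<ge> 5\<close> every other term of the relation at \<open>m = 2\<close> is too far from \<open>D (P 2)\<close>.
\<close>

lemma var_D_coeff_1_large:
  assumes "n \<ge> 5"
  shows "var_D_coeff 1 (P n) = 0"
proof -
  obtain y where y: "D y = var * D (P n)" using D_surj by blast
  have "var_D_coeff 2 (var * P n) = 0"
  proof (rule fourier_vanish[OF linear_var_D_coeff])
    fix j show "L (var * P n * P j) = 0 \<or> var_D_coeff 2 (P j) = 0"
      using var_orth[of j n] var_D_coeff_banded[of 2 j] assms by (cases "j + 1 < n") auto
  qed simp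
  moreover have "L (var * (var * P n) * P 2) = 0" "L (var * P n * P 2) = 0"
    using var_var_orth[of 2 n] var_orth[of 2 n] assms by simp_all
  moreover have "var_D_coeff 2 (P n) = 0" "L (P n * P 2) = 0"
    using var_D_coeff_banded[of 2 n] assms by (simp_all add: orth)
  ultimately have "var_D_coeff 2 y = 0" using var_D_coeff_relation[of 2, OF _ y] by simp
  moreover have "var_D_coeff 2 y = L (y * P 1) / d 1 * var_D_coeff 2 (P 1)"
  proof (rule fourier_single[OF linear_var_D_coeff])
    fix j :: nat assume "j \<noteq> 1"
    then consider "j = 0" | "2 \<le> j" "j + 1 < n" | "j \<ge> 4" using assms by linarith
    thus "L (y * P j) = 0 \<or> var_D_coeff 2 (P j) = 0"
    proof cases
      case 2
      thus ?thesis using var_D_coeff_antidifference[OF _ y, of j] var_D_coeff_banded[of j n] by simp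
    qed (use var_D_coeff_0[of 2] var_D_coeff_banded[of 2 j] in auto)
  qed simp
  ultimately have "L (y * P 1) = 0" using var_D_coeff_2_1 d_nz[of 1] by simp
  thus ?thesis using var_D_coeff_antidifference[OF _ y, of 1] by simp
qed

text \<open>
For \<open>n = 3, 4\<close> the bands overlap, and two rows of the relation for \<open>P (n + 1)\<close> are compared. In the row
\<open>m\<close>, everything except the term from \<open>x\<^sup>2 P (n + 1)\<close> collapses to \<open>\<theta> * var_D_coeff m (P n)\<close>, with the
same \<open>\<theta>\<close> for all \<open>m\<close>. For \<open>m = n - 1\<close> the former term is nonzero, hence \<open>\<theta> \<noteq> 0\<close>; for \<open>m = 1\<close> it is zero.
\<close>

lemma var_D_coeff_1_descent:
  assumes "n \<ge> 3" "\<And>j. j > n \<Longrightarrow> var_D_coeff 1 (P j) = 0"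
  shows "var_D_coeff 1 (P n) = 0"
proof -
  let ?h = "P (n + 1)"
  obtain y where y: "D y = var * D ?h" using D_surj by blast
  define \<theta> where "\<theta> = (var_D_coeff n ?h - 2 * \<alpha> * L (var * ?h * P n)) / d n"
  have low: "L (y * P j) = 0" if "1 \<le> j" "j < n" for j
  proof (cases "j = 1")
    case True
    thus ?thesis using var_D_coeff_antidifference[OF _ y, of j] assms(2)[of "n + 1"] by simp
  next
    case False
    thus ?thesis using var_D_coeff_antidifference[OF _ y, of j] var_D_coeff_banded[of j "n + 1"] that by simp
  qed
  have row: "L (var * (var * ?h) * P m) + \<theta> * var_D_coeff m (P n) = 0"
    if m: "m \<ge> 1" "m + 1 \<le> n" and van: "\<And>j. j > n \<Longrightarrow> var_D_coeff m (P j) = 0" for m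
  proof -
    have "var_D_coeff m (var * ?h) = L (var * ?h * P n) / d n * var_D_coeff m (P n)"
    proof (rule fourier_single[OF linear_var_D_coeff[OF m(1)]])
      fix j assume "j \<noteq> n"
      thus "L (var * ?h * P j) = 0 \<or> var_D_coeff m (P j) = 0"
        using var_orth[of j "n + 1"] van[of j] by (cases "j < n") auto
    qed
    moreover have "var_D_coeff m y = L (y * P n) / d n * var_D_coeff m (P n)"
    proof (rule fourier_single[OF linear_var_D_coeff[OF m(1)]])
      fix j assume "j \<noteq> n"
      thus "L (y * P j) = 0 \<or> var_D_coeff m (P j) = 0"
        using low[of j] van[of j] var_D_coeff_0[OF m(1)] by (cases "j < n"; cases "j = 0") auto
    qed
    moreover have "L (y * P n) = var_D_coeff n ?h" using var_D_coeff_antidifference[OF _ y, of n] assms(1) by simp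
    moreover have "L (var * ?h * P m) = 0" "L (?h * P m) = 0" "var_D_coeff m ?h = 0"
      using var_orth[of m "n + 1"] m(2) van[of "n + 1"] by (simp_all add: orth)
    ultimately show ?thesis
      using var_D_coeff_relation[OF m(1) y] by (simp add: \<theta>_def diff_divide_distrib algebra_simps)
  qed
  have "\<theta> * var_D_coeff 1 (P n) = 0"
    using row[of 1] assms var_var_orth[of 1 "n + 1"] by simp
  moreover have "L (var * (var * ?h) * P (n - 1)) + \<theta> * var_D_coeff (n - 1) (P n) = 0"
    by (rule row) (use assms(1) var_D_coeff_banded[of "n - 1"] in auto)
  hence "\<theta> \<noteq> 0" using var_var_lead[of "n - 1"] assms(1) by auto
  ultimately show ?thesis by simp
qed

lemma var_D_coeff_1: "n \<ge> 3 \<Longrightarrow> var_D_coeff 1 (P n) = 0"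
proof -
  assume n: "n \<ge> 3"
  have 4: "var_D_coeff 1 (P j) = 0" if "j > 3" for j
    using var_D_coeff_1_large[of j] var_D_coeff_1_descent[of 4] var_D_coeff_1_large that by (cases "j = 4") simp_all
  thus "var_D_coeff 1 (P n) = 0"
    using var_D_coeff_1_descent[of 3] n by (cases "n = 3") simp_all
qed

definition \<psi> where "\<psi> = P 1"
text \<open>
The sum represents the functional \<open>var_D_coeff 1\<close>, which vanishes on \<open>P n\<close> for \<open>n \<ge> 3\<close>. Subtracting \<open>p \<psi>\<close>
makes the sum the value of \<open>Op\<close> at \<open>x\<close>.
\<close>

definition \<phi> where "\<phi> = (\<Sum>m<3. cst (var_D_coeff 1 (P m) / d m) * P m) - p * \<psi>"
definition Op where "Op g = \<phi> * D g + \<psi> * S g"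

lemma degree_p: "degree p \<le> 1"
  unfolding p_def by (rule degree_add_le) (use degree_mult_le[of A var] in simp_all)

lemma degree_phi: "degree \<phi> \<le> 2"
proof -
  have "degree (\<Sum>m<3. cst (var_D_coeff 1 (P m) / d m) * P m) \<le> 2"
  proof (rule degree_sum_le)
    fix m :: nat assume "m \<in> {..<3}"
    thus "degree (cst (var_D_coeff 1 (P m) / d m) * P m) \<le> 2"
      using degree_mult_le[of "cst (var_D_coeff 1 (P m) / d m)" "P m"] degree_P[of m] by auto
  qed simp
  moreover have "degree (p * \<psi>) \<le> 2"
    using degree_mult_le[of p \<psi>] degree_p degree_P[of 1] unfolding \<psi>_def by simp
  ultimately show ?thesis unfolding \<phi>_def by (rule degree_diff_le)
qed

lemma Op_1: "Op 1 = \<psi>" and Op_var: "Op var = (\<Sum>m<3. cst (var_D_coeff 1 (P m) / d m) * P m)"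
  by (simp_all add: Op_def D_one S_one D_varp S_varp \<phi>_def ac_simps)

lemma D_coeff_1_var: "D_coeff 1 (var * D f) = L (Op var * f)"
proof -
  have "L (Op var * f) = L (f * Op var)" by (simp add: mult.commute)
  also have "\<dots> = (\<Sum>m<3. var_D_coeff 1 (P m) / d m * L (f * P m))"
    unfolding Op_var by (rule linear_functional_sum[OF linear_functional_L_mult'])
  also have "\<dots> = (\<Sum>m<Suc (degree f + 2). L (f * P m) / d m * var_D_coeff 1 (P m))"
    by (rule sum.mono_neutral_cong_left) (use var_D_coeff_1 in auto)
  also have "\<dots> = var_D_coeff 1 f" by (rule fourier[OF linear_var_D_coeff, symmetric]) simp_all
  finally show ?thesis by (simp add: var_D_coeff_def)
qed

text \<open>
The adjoint of \<open>D\<close>, from the functional \<open>D_coeff 1\<close> to \<open>L\<close>, is a first-order operator: it inherits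
the recursion of \<open>first_order_quad\<close> by duality and agrees with \<open>Op\<close> on 1 and \<open>x\<close>.
\<close>

lemma D_coeff_1_Op: "D_coeff 1 (g * D f) = L (Op g * f)"
proof -
  define ok where "ok g \<longleftrightarrow> (\<forall>f. D_coeff 1 (g * D f) = L (Op g * f))" for g
  note lin = linear_functionalD[OF linear_D_coeff[OF order_refl], unfolded One_nat_def]
  have Op_add: "Op (f + g) = Op f + Op g" and Op_cst: "Op (cst c * f) = cst c * Op f" for f g c
    by (simp_all add: Op_def Dl Sl distrib_left mult.left_commute[of _ "cst c"])
  have ok_add: "ok g \<Longrightarrow> ok h \<Longrightarrow> ok (g + h)" for g h
    by (simp add: ok_def Op_add distrib_right lin Ll)
  have ok_cst: "ok g \<Longrightarrow> ok (cst c * g)" for g c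
    by (simp add: ok_def Op_cst mult.assoc lin Ll)
  have "D_coeff 1 (D f) = L (\<psi> * f)" for f
    using D_coeff_D[of 1 f] by (simp add: \<psi>_def mult.commute)
  hence ok1: "ok 1" by (simp add: ok_def Op_1)
  have okv: "ok var" unfolding ok_def using D_coeff_1_var by blast
  have step: "ok (var * (var * g))" if g: "ok g" "ok (var * g)" for g
    unfolding ok_def
  proof
    fix f
    have w1: "w1 = var ^ 2 - 2 * B * var + (B ^ 2 - cst \<delta>)"
      unfolding w1_def p_def U_def by (simp add: algebra_simps power2_eq_square)
    have qf: "D (var * (var * f)) = 2 * p * D (var * f) - w1 * D f"
      by (rule first_order_quad[of D 1 0]) simp
    have qg: "Op (var * (var * g)) = 2 * p * Op (var * g) - w1 * Op g"
      by (rule first_order_quad[of Op \<phi> \<psi>]) (rule Op_def)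
    have "var * (var * g) * D f = cst (2 * \<alpha>) * ((var * g) * D (var * f)) + cst (2 * \<beta>) * (g * D (var * f))
       - g * D (var * (var * f)) + cst (2 * \<beta>) * ((var * g) * D f) - cst (\<beta>\<^sup>2 - \<delta>) * (g * D f)"
      unfolding qf w1 p_def by (simp add: cst_hom algebra_simps power2_eq_square)
    hence "D_coeff 1 (var * (var * g) * D f) = L (cst (2 * \<alpha>) * (Op (var * g) * (var * f)) + cst (2 * \<beta>) * (Op g * (var * f))
       - Op g * (var * (var * f)) + cst (2 * \<beta>) * (Op (var * g) * f) - cst (\<beta>\<^sup>2 - \<delta>) * (Op g * f))"
      using g by (simp add: lin Ll ok_def)
    also have "\<dots> = L (Op (var * (var * g)) * f)"
      unfolding qg w1 p_def by (rule arg_cong[where f = L]) (simp add: cst_hom algebra_simps power2_eq_square)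
    finally show "D_coeff 1 (var * (var * g) * D f) = L (Op (var * (var * g)) * f)" .
  qed
  have "ok g \<and> ok (var * g)" for g
  proof (induction g rule: poly_var_induct)
    case (const c)
    show ?case using ok_cst[OF ok1, of c] ok_cst[OF okv, of c] by (simp add: mult.commute)
  next
    case (add f g)
    thus ?case using ok_add[of f g] ok_add[of "var * f" "var * g"] by (simp add: distrib_left)
  qed (use step in blast)
  thus ?thesis by (simp add: ok_def)
qed

text \<open>
The operator \<open>Op D\<close> is \<open>D\<close> followed by its adjoint, hence symmetric for \<open>L\<close>, and it does not raise degrees.
\<close>

lemma difference_equation:
  "\<exists>l. \<phi> * D (D (P n)) + \<psi> * S (D (P n)) + cst l * P n = 0"
proof -
  have sym: "L (Op (D f) * g) = L (Op (D g) * f)" for f g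
    unfolding D_coeff_1_Op[symmetric] by (simp add: mult.commute)
  have deg: "degree (Op (D f)) \<le> degree f" for f
  proof (cases "degree f = 0")
    case True
    then obtain c where "f = [:c:]" by (rule degree_eq_zeroE)
    thus ?thesis using D_cst[of c] by (simp add: cst_def Op_def Dl Sl)
  next
    case False
    have "degree (\<phi> * D (D f)) \<le> degree f"
    proof (cases "degree f = 1")
      case True
      hence "degree (D f) = 0" by (simp add: degree_D)
      then obtain c where "D f = [:c:]" by (rule degree_eq_zeroE)
      thus ?thesis using D_cst[of c] by (simp add: cst_def)
    next
      case False
      thus ?thesis using \<open>degree f \<noteq> 0\<close> degree_mult_le[of \<phi> "D (D f)"] degree_phi by (simp add: degree_D)
    qed
    moreover have "degree (\<psi> * S (D f)) \<le> degree f"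
      using degree_mult_le[of \<psi> "S (D f)"] degree_S_le[of "D f"] degree_D[of f] False degree_P[of 1]
      by (simp add: \<psi>_def)
    ultimately show ?thesis unfolding Op_def by (rule degree_add_le)
  qed
  have "L (Op (D (P n)) * P m) = 0" if "m < n" for m
    using sym[of "P n" "P m"] orth_low[of "Op (D (P m))" n] deg[of "P m"] degree_P[of m] that by simp
  from eq_mult_P[OF deg[of "P n", unfolded degree_P] this]
  have "\<phi> * D (D (P n)) + \<psi> * S (D (P n)) = cst (L (Op (D (P n)) * P n) / d n) * P n"
    by (simp add: Op_def)
  hence "\<phi> * D (D (P n)) + \<psi> * S (D (P n)) + cst (- (L (Op (D (P n)) * P n) / d n)) * P n = 0"
    by (simp add: cst_hom)
  thus ?thesis by blast
qed

end

section \<open>From the difference equation to a Pearson equation\<close>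

context lattice_polynomials
begin

lemma degree_X: "degree X \<le> 1"
proof -
  have "X = cst (2 * \<alpha>\<^sup>2 - 1) * var + cst (2 * \<beta> * (\<alpha> + 1))" by (simp add: X_def cst_hom)
  thus ?thesis using degree_mult_le[of "cst (2 * \<alpha>\<^sup>2 - 1)" var] by (simp add: degree_add_le)
qed

lemma U_coeffs: "U = [:\<delta>, 2 * \<beta> * (\<alpha> + 1), \<alpha>\<^sup>2 - 1:]"
proof -
  have "U = cst \<delta> + var * (cst (2 * \<beta> * (\<alpha> + 1)) + var * (cst (\<alpha>\<^sup>2 - 1)))"
    by (simp add: U_def cst_hom algebra_simps power2_eq_square)
  also have "\<dots> = [:\<delta>, 2 * \<beta> * (\<alpha> + 1), \<alpha>\<^sup>2 - 1:]" by (simp add: cst_def var_def)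
  finally show ?thesis .
qed

lemma degree_U: "degree U \<le> 2"
  by (simp add: U_coeffs)

lemma degree_W: "degree W \<le> 2"
proof -
  have "degree (X ^ 2) \<le> 2" using degree_power_le[of X 2] degree_X by simp
  moreover have "degree (4 * A ^ 2 * U) \<le> 2"
  proof -
    have e: "4 * A ^ 2 * U = cst (4 * \<alpha>\<^sup>2) * U" by (simp add: cst_hom)
    show ?thesis unfolding e using degree_mult_le[of "cst (4 * \<alpha>\<^sup>2)" U] degree_U by simp
  qed
  ultimately show ?thesis unfolding W_def by (rule degree_diff_le)
qed

end

locale hypergeometric_operator = lattice_polynomials +
  fixes \<phi> \<psi> :: "real poly"
  assumes degree_phi: "degree \<phi> \<le> 2" and degree_psi: "degree \<psi> = 1"
begin

definition T where "T f = \<phi> * D (D f) + \<psi> * S (D f)"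
definition T' where "T' f = \<phi> * S (D f) + U * \<psi> * D (D f)"
definition \<pi> where "\<pi> = \<phi> ^ 2 - U * \<psi> ^ 2"

lemma linear_T: "linear_op T"
  by (simp add: linear_op_def T_def Dl Sl distrib_left mult.left_commute[of _ "cst c" for c])

lemmas Tl = linear_opD[OF linear_T]

lemma degree_T: "degree (T f) \<le> degree f"
proof (cases "degree f")
  case 0
  then obtain c where "f = [:c:]" by (rule degree_eq_zeroE)
  thus ?thesis using D_cst[of c] by (simp add: cst_def T_def Dl Sl)
next
  case (Suc n)
  have "degree (\<phi> * D (D f)) \<le> degree f"
  proof (cases n)
    case 0
    hence "degree (D f) = 0" by (simp add: degree_D Suc)
    then obtain c where "D f = [:c:]" by (rule degree_eq_zeroE)
    thus ?thesis using D_cst[of c] by (simp add: cst_def)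
  next
    case (Suc m)
    thus ?thesis using \<open>degree f = Suc n\<close> degree_mult_le[of \<phi> "D (D f)"] degree_phi by (simp add: degree_D)
  qed
  moreover have "degree (\<psi> * S (D f)) \<le> degree f"
    using degree_mult_le[of \<psi> "S (D f)"] degree_S_le[of "D f"] degree_D[of f] Suc degree_psi by simp
  ultimately show ?thesis unfolding T_def by (rule degree_add_le)
qed

text \<open>
Apply the commutation rule to \<open>P (n + 2)\<close>. Modulo polynomials orthogonal to all degrees below \<open>n\<close>, the
only term that survives is a nonzero multiple of \<open>T (P n)\<close>, which comes from the component
of \<open>x\<^sup>2 P (n + 2)\<close> along \<open>P n\<close>.
\<close>

lemma eigen_descent:
  assumes "\<And>m. m > n \<Longrightarrow> \<exists>\<mu>. T (P m) = cst \<mu> * P m"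
  shows "\<exists>\<mu>. T (P n) = cst \<mu> * P n"
proof -
  let ?f = "P (n + 2)"
  \<comment> \<open>By hypothesis \<open>T\<close> preserves the span of the \<open>P m\<close> with \<open>m > n\<close>.\<close>
  have eig: "L (T f * g) = 0"
    if f: "\<And>m. m \<le> n \<Longrightarrow> L (f * P m) = 0" and g: "degree g \<le> n" for f g
  proof (rule fourier_vanish[of "\<lambda>f. L (T f * g)"])
    show "linear_functional (\<lambda>f. L (T f * g))"
      by (simp add: linear_functional_def Tl Ll distrib_right mult.assoc)
    fix m
    show "L (f * P m) = 0 \<or> L (T (P m) * g) = 0"
    proof (cases "m \<le> n")
      case False
      then obtain \<mu> where "T (P m) = cst \<mu> * P m" using assms[of m] by auto
      thus ?thesis using orth_low'[of g m] g False by (simp add: Ll mult.assoc)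
    qed (use f in simp)
  qed
  have vf: "L (var * ?f * P m) = 0" if "m \<le> n" for m
    using orth_low[of "var * P m" "n + 2"] degree_mult_le[of var "P m"] degree_P[of m] that by (simp add: ac_simps)
  define c where "c = L (var * (var * ?f) * P n) / d n"
  define g where "g = var * (var * ?f) - cst c * P n"
  have g: "L (g * P m) = 0" if "m \<le> n" for m
  proof (cases "m = n")
    case True
    thus ?thesis by (simp add: g_def left_diff_distrib Ll mult.assoc orth c_def d_nz)
  next
    case False
    have "L (var * (var * ?f) * P m) = 0"
      using orth_low[of "var * var * P m" "n + 2"] degree_mult_le[of "var * var" "P m"]
        degree_mult_le[of var var] degree_P[of m] that False by (simp add: ac_simps)
    thus ?thesis using False by (simp add: g_def left_diff_distrib Ll mult.assoc orth)
  qed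
  have c: "c \<noteq> 0"
  proof -
    have nz: "var * var * P n \<noteq> 0" using P_nz[of n] by (simp add: var_def)
    hence "degree (var * var * P n) = n + 2" by (simp add: degree_mult_eq degree_P)
    from orth_lead_nz[OF this nz] show ?thesis by (simp add: ac_simps c_def d_nz)
  qed
  have "L (T (P n) * P j) = 0" if j: "j < n" for j
  proof -
    let ?\<kappa> = "\<psi> * (var - X) + 2 * A * \<phi>"
    have "T (var * (var * ?f)) = 2 * X * T (var * ?f) - W * T ?f + ?\<kappa> * ?f"
      by (rule second_order_quad) (rule T_def)
    moreover have "T (var * (var * ?f)) = T g + cst c * T (P n)"
      by (simp add: g_def Tl)
    ultimately have "cst c * (T (P n) * P j)
        = cst 2 * (T (var * ?f) * (X * P j)) - T ?f * (W * P j) + ?\<kappa> * P j * ?f - T g * P j"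
      by (simp add: cst_hom) algebra
    hence "c * L (T (P n) * P j) = 2 * L (T (var * ?f) * (X * P j)) - L (T ?f * (W * P j))
        + L (?\<kappa> * P j * ?f) - L (T g * P j)"
      using arg_cong[of _ _ L] by (simp only: Ll flip: Ll(2))
    moreover have "L (T (var * ?f) * (X * P j)) = 0"
      by (rule eig[OF vf]) (use degree_mult_le[of X "P j"] degree_X degree_P[of j] j in auto)
    moreover have "L (T g * P j) = 0" by (rule eig[OF g]) (use degree_P j in auto)
    moreover have "L (T ?f * (W * P j)) = 0"
    proof -
      obtain \<mu> where "T ?f = cst \<mu> * ?f" using assms[of "n + 2"] by auto
      thus ?thesis using orth_low'[of "W * P j" "n + 2"] degree_mult_le[of W "P j"] degree_W degree_P[of j] j
        by (simp add: Ll mult.assoc)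
    qed
    moreover have "L (?\<kappa> * P j * ?f) = 0"
    proof (rule orth_low)
      have "degree (\<psi> * (var - X)) \<le> 2"
        using degree_mult_le[of \<psi> "var - X"] degree_diff_le[of var 1 X] degree_X degree_psi by simp
      moreover have "degree (2 * A * \<phi>) \<le> 2"
      proof -
        have e: "2 * A * \<phi> = cst (2 * \<alpha>) * \<phi>" by (simp add: cst_hom)
        show ?thesis unfolding e using degree_mult_le[of "cst (2 * \<alpha>)" \<phi>] degree_phi by simp
      qed
      ultimately have "degree ?\<kappa> \<le> 2" by (rule degree_add_le)
      thus "degree (?\<kappa> * P j) < n + 2" using degree_mult_le[of ?\<kappa> "P j"] degree_P[of j] j by simp
    qed
    ultimately show ?thesis using c by simp
  qed
  from eq_mult_P[OF degree_T[of "P n", unfolded degree_P] this] show ?thesis by blast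
qed

end

locale hypergeometric_polynomials = hypergeometric_operator +
  assumes eigen_large: "n \<ge> 5 \<Longrightarrow> \<exists>\<mu>. T (P n) = cst \<mu> * P n"
begin

lemma eigen_exists: "\<exists>\<mu>. T (P n) = cst \<mu> * P n"
proof (induction "5 - n" arbitrary: n rule: less_induct)
  case less
  show ?case
  proof (cases "n \<ge> 5")
    case False
    show ?thesis
    proof (rule eigen_descent)
      fix m assume "m > n"
      show "\<exists>\<mu>. T (P m) = cst \<mu> * P m" by (rule less) (use \<open>m > n\<close> False in simp)
    qed
  qed (rule eigen_large)
qed

definition \<mu> where "\<mu> n = (SOME \<mu>. T (P n) = cst \<mu> * P n)"

lemma eigen: "T (P n) = cst (\<mu> n) * P n"
  unfolding \<mu>_def by (rule someI_ex[OF eigen_exists])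

text \<open>
As \<open>D\<close> is onto, this says \<open>L (T f) = 0\<close> for all \<open>f\<close>, and \<open>T (P n)\<close> is orthogonal to the constants.
\<close>

lemma pearson: "L (\<phi> * D h + \<psi> * S h) = 0"
proof -
  obtain f where f: "D f = h" using D_surj by blast
  have lin: "linear_functional (\<lambda>f. L (T f))" by (simp add: linear_functional_def Tl Ll)
  have "L (T f) = 0"
  proof (rule fourier_vanish[OF lin])
    fix m
    show "L (f * P m) = 0 \<or> L (T (P m)) = 0"
    proof (cases "m = 0")
      case True
      obtain c where "P 0 = [:c:]" using degree_P[of 0] degree_eq_zeroE by blast
      thus ?thesis using D_cst[of c] True by (simp add: cst_def T_def Dl Sl Ll)
    next
      case False
      thus ?thesis using orth_low[of 1 m] by (simp add: eigen Ll)
    qed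
  qed
  thus ?thesis by (simp add: T_def f)
qed

text \<open>
Integration by parts: the Pearson equation for \<open>h D f\<close>, expanded by the product rules.
\<close>

lemma green: "L (S h * T f) = - L (D h * T' f)"
proof -
  have "S h * T f + D h * T' f = \<phi> * D (h * D f) + \<psi> * S (h * D f)"
    by (simp add: T_def T'_def D_mult S_mult algebra_simps)
  from arg_cong[OF this, of L] pearson[of "h * D f"] show ?thesis by (simp only: Ll)
qed

text \<open>
Cramer's rule for the system that defines \<open>T\<close> and \<open>T'\<close>, whose determinant is \<open>\<pi>\<close>.
\<close>

lemma pi_DD: "\<pi> * D (D f) = \<phi> * T f - \<psi> * T' f"
  and pi_SD: "\<pi> * S (D f) = \<phi> * T' f - U * \<psi> * T f"
  by (simp_all add: \<pi>_def T_def T'_def algebra_simps power2_eq_square)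

lemma psi_nz: "\<psi> \<noteq> 0" using degree_psi by auto

text \<open>
If \<open>\<phi>\<^sup>2 = U \<psi>\<^sup>2\<close>, then \<open>\<phi> = \<psi> V\<close> with \<open>V\<^sup>2 = U\<close>, and the Pearson equation becomes \<open>L (\<psi> (V D h + S h)) = 0\<close>.
The operator \<open>V D + S\<close> is onto, so \<open>\<psi>\<close> would be orthogonal to everything.
\<close>

lemma pi_nz: "\<pi> \<noteq> 0"
proof
  assume z: "\<pi> = 0"
  hence eq: "\<phi> ^ 2 = U * \<psi> ^ 2" by (simp add: \<pi>_def)
  hence "\<psi> ^ 2 dvd \<phi> ^ 2" by simp
  hence "\<psi> dvd \<phi>"
  proof -
    define a b where "a = coeff \<psi> 0" and "b = coeff \<psi> 1"
    have ab: "\<psi> = [:a, b:]" "b \<noteq> 0"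
      using degree_le_1_eq[of \<psi>] degree_psi leading_coeff_0_iff[of \<psi>] by (auto simp: a_def b_def)
    hence "\<psi> = smult b [:- (- a / b), 1:]" by simp
    moreover have "poly \<psi> (- a / b) = 0" using ab by simp
    hence "poly (\<phi> ^ 2) (- a / b) = 0" unfolding eq by simp
    hence "[:- (- a / b), 1:] dvd \<phi>" by (simp add: poly_eq_0_iff_dvd)
    ultimately show ?thesis using ab(2) by (simp only: smult_dvd_iff) simp
  qed
  then obtain V where V: "\<phi> = \<psi> * V" by (rule dvdE)
  have VU: "V ^ 2 = U" using eq psi_nz by (simp add: V power_mult_distrib)
  have degV: "degree V \<le> 1"
    using degree_phi degree_psi psi_nz by (cases "V = 0") (simp_all add: V degree_mult_eq)
  define v where "v = coeff V 1"
  have v: "v\<^sup>2 = \<alpha>\<^sup>2 - 1"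
  proof -
    have "coeff (V * V) (1 + 1) = v * v" unfolding v_def by (rule coeff_mult_top[OF degV degV])
    moreover have "V * V = U" using VU by (simp add: power2_eq_square)
    moreover have "coeff U (1 + 1) = \<alpha>\<^sup>2 - 1" by (simp add: U_coeffs)
    ultimately show ?thesis by (simp add: power2_eq_square)
  qed
  define F where "F f = V * D f + S f" for f
  have linF: "linear_op F"
    by (simp add: linear_op_def F_def Dl Sl distrib_left mult.left_commute[of _ "cst c" for c])
  have lead: "\<exists>f. (\<forall>i\<ge>n + 0 + 1. coeff f i = 0) \<and> (\<forall>i\<ge>n + 1. coeff (F f) i = 0) \<and> coeff (F f) n \<noteq> 0" for n
  proof (intro exI conjI)
    let ?f = "monom (1::real) n"
    have dn: "degree ?f = n" by (simp add: degree_monom_eq)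
    show "\<forall>i\<ge>n + 0 + 1. coeff ?f i = 0" by simp
    have cV: "degree (V * D ?f) \<le> n \<and> coeff (V * D ?f) n = v * lead_D \<alpha> n"
    proof (cases n)
      case 0
      have "D ?f = 0" using D_one 0 by (simp add: one_pCons monom_0)
      thus ?thesis using 0 by simp
    next
      case (Suc m)
      have dm: "degree (D ?f) = m" using degree_D[of ?f] dn Suc by simp
      have "coeff (V * D ?f) n = v * coeff (D ?f) m"
        using coeff_mult_top[OF degV, of "D ?f" m] dm Suc by (simp add: v_def)
      also have "coeff (D ?f) m = lead_D \<alpha> n" using coeff_D[of ?f m] dn Suc by simp
      finally show ?thesis using degree_mult_le[of V "D ?f"] degV dm Suc by simp
    qed
    have "degree (F ?f) \<le> n"
      unfolding F_def using cV degree_S_le[of ?f] dn by (intro degree_add_le) auto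
    thus "\<forall>i\<ge>n + 1. coeff (F ?f) i = 0" by (auto intro!: coeff_eq_0)
    have "coeff (F ?f) n = lead_S \<alpha> n + v * lead_D \<alpha> n"
      using cV coeff_S[of ?f n] dn by (simp add: F_def)
    moreover have "(lead_S \<alpha> n + v * lead_D \<alpha> n) * (lead_S \<alpha> n - v * lead_D \<alpha> n) = 1"
      using lead_D_S_pell[of \<alpha> n] unfolding v[symmetric] by (simp add: power2_eq_square algebra_simps)
    ultimately show "coeff (F ?f) n \<noteq> 0" by auto
  qed
  have "\<psi> = 0"
  proof (rule nondegenerate)
    fix m
    obtain f where f: "F f = P m"
      using linear_op_surj[OF linF lead, of "Suc m" "P m"] degree_P[of m] by (auto simp: coeff_eq_0)
    have "\<psi> * P m = \<phi> * D f + \<psi> * S f" by (simp add: f[symmetric] F_def V algebra_simps)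
    thus "L (\<psi> * P m) = 0" using pearson[of f] by simp
  qed
  thus False using psi_nz by simp
qed

text \<open>
If \<open>T (P n) = 0\<close>, then Green's formula makes \<open>T' (P n)\<close> orthogonal to every \<open>D h\<close>, hence zero, and
Cramer's rule gives \<open>\<pi> S (D (P n)) = 0\<close>.
\<close>

lemma mu_nz:
  assumes "n \<ge> 1"
  shows "\<mu> n \<noteq> 0"
proof
  assume z: "\<mu> n = 0"
  have T: "T (P n) = 0" using eigen[of n] z by (simp add: cst_hom)
  have "T' (P n) = 0"
  proof (rule nondegenerate)
    fix m
    obtain h where "D h = P m" using D_surj by blast
    thus "L (T' (P n) * P m) = 0" using green[of h "P n"] T by (simp add: Ll mult.commute)
  qed
  hence "\<pi> * S (D (P n)) = 0" using T by (simp add: pi_SD)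
  moreover have "S (D (P n)) \<noteq> 0"
  proof -
    have "D (P n) \<noteq> 0" using D_eq_0[of "P n"] degree_P[of n] assms by auto
    hence "coeff (S (D (P n))) (degree (D (P n))) \<noteq> 0"
      using coeff_S[of "D (P n)" "degree (D (P n))"] lead_D_S_pos[OF alpha] by (simp add: less_le)
    thus ?thesis by auto
  qed
  ultimately show False using pi_nz by simp
qed

lemma mu_lead: "\<mu> (Suc n) = lead_D \<alpha> (Suc n) * (coeff \<phi> 2 * lead_D \<alpha> n + coeff \<psi> 1 * lead_S \<alpha> n)"
proof -
  let ?Q = "P (Suc n)"
  have dD: "degree (D ?Q) \<le> n" using degree_D[of ?Q] degree_P[of "Suc n"] by simp
  have cD: "coeff (D ?Q) n = lead_D \<alpha> (Suc n) * coeff ?Q (Suc n)"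
    by (rule coeff_D) (simp add: degree_P)
  have "coeff (\<psi> * S (D ?Q)) (Suc n) = coeff \<psi> 1 * (lead_S \<alpha> n * coeff (D ?Q) n)"
  proof -
    have "degree (S (D ?Q)) \<le> n" using degree_S_le[of "D ?Q"] dD by simp
    hence "coeff (\<psi> * S (D ?Q)) (1 + n) = coeff \<psi> 1 * coeff (S (D ?Q)) n"
      using degree_psi by (intro coeff_mult_top) auto
    thus ?thesis using coeff_S[OF dD] by simp
  qed
  moreover have "coeff (\<phi> * D (D ?Q)) (Suc n) = coeff \<phi> 2 * (lead_D \<alpha> n * coeff (D ?Q) n)"
  proof (cases n)
    case 0
    obtain c where "D ?Q = [:c:]" using dD 0 degree_eq_zeroE by (metis le_zero_eq)
    hence "D (D ?Q) = 0" using D_cst[of c] by (simp add: cst_def)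
    thus ?thesis using 0 by simp
  next
    case (Suc m)
    have "degree (D (D ?Q)) \<le> m" using degree_D[of "D ?Q"] dD Suc by simp
    hence "coeff (\<phi> * D (D ?Q)) (2 + m) = coeff \<phi> 2 * coeff (D (D ?Q)) m"
      using degree_phi by (intro coeff_mult_top) auto
    thus ?thesis using coeff_D[of "D ?Q" m] dD Suc by simp
  qed
  moreover have "coeff (T ?Q) (Suc n) = \<mu> (Suc n) * coeff ?Q (Suc n)" by (simp add: eigen)
  ultimately have "\<mu> (Suc n) * coeff ?Q (Suc n)
      = lead_D \<alpha> (Suc n) * (coeff \<phi> 2 * lead_D \<alpha> n + coeff \<psi> 1 * lead_S \<alpha> n) * coeff ?Q (Suc n)"
    unfolding T_def cD by (simp add: algebra_simps del: lead_D.simps)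
  thus ?thesis using lead_P[of "Suc n"] by (simp del: lead_D.simps)
qed

end

section \<open>Structure relations\<close>

context orthogonal_basis
begin

lemma banded_expansion:
  assumes "degree f \<le> n + 2" "\<And>m. m + 2 < n \<Longrightarrow> L (f * P m) = 0"
  shows "f = (\<Sum>m = n - 2..n + 2. cst (L (f * P m) / d m) * P m)"
proof -
  have "f = (\<Sum>m<n + 3. cst (L (f * P m) / d m) * P m)"
    by (rule expansion) (use assms(1) in \<open>auto intro!: coeff_eq_0\<close>)
  also have "\<dots> = (\<Sum>m = n - 2..n + 2. cst (L (f * P m) / d m) * P m)"
    by (rule sum.mono_neutral_right) (use assms(2) in \<open>auto simp: cst_hom\<close>)
  finally show ?thesis .
qed

end

context lattice_polynomials
begin

lemma degree_R: "degree (R n) = n - 2"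
  by (simp add: degree_D degree_P)

lemma R_nz: "n \<ge> 2 \<Longrightarrow> R n \<noteq> 0"
  using D_eq_0[of "D (P n)"] degree_D[of "P n"] degree_P[of n] by auto

text \<open>
\<open>\<pi> R n\<close> has no components below \<open>P (n - 2)\<close>, while \<open>R m\<close> has degree \<open>m - 2\<close>. For \<open>m \<le> n\<close>, which
suffices by symmetry, the two meet only if \<open>m = n\<close>, in the component along \<open>P (n - 2)\<close>.
\<close>

lemma structure_relation_imp_orthogonal:
  assumes "\<And>n. n \<ge> 2 \<Longrightarrow> a n (n - 2) \<noteq> 0"
    and rel: "\<And>n. n \<ge> 2 \<Longrightarrow> \<pi> * R n = (\<Sum>m = n - 2..n + 2. cst (a n m) * P m)"
    and "m \<ge> 2" "n \<ge> 2"
  shows "L (R m * R n * \<pi>) = 0 \<longleftrightarrow> m \<noteq> n"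
proof -
  have val: "L (R m * R n * \<pi>) = (\<Sum>j = n - 2..n + 2. a n j * L (R m * P j))" if "n \<ge> 2" for m n
  proof -
    have "L (R m * R n * \<pi>) = L (R m * (\<pi> * R n))" by (simp add: ac_simps)
    also have "\<dots> = (\<Sum>j = n - 2..n + 2. a n j * L (R m * P j))"
      unfolding rel[OF that] by (rule linear_functional_sum[OF linear_functional_L_mult'])
    finally show ?thesis .
  qed
  have less: "L (R m * R n * \<pi>) = 0" if "m < n" "m \<ge> 2" for m n
  proof -
    have "(\<Sum>j = n - 2..n + 2. a n j * L (R m * P j)) = 0"
    proof (rule sum.neutral, rule ballI)
      fix j assume "j \<in> {n - 2..n + 2}"
      hence "degree (R m) < j" using that degree_R[of m] by auto
      thus "a n j * L (R m * P j) = 0" by (simp add: orth_low)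
    qed
    thus ?thesis using val[of n m] that by simp
  qed
  have eq: "L (R n * R n * \<pi>) \<noteq> 0" if "n \<ge> 2" for n
  proof -
    \<comment> \<open>The degree of \<open>R n\<close> is \<open>n - 2\<close>, so only the lowest term of the relation contributes.\<close>
    have "(\<Sum>j = n - 2..n + 2. a n j * L (R n * P j)) = (\<Sum>j \<in> {n - 2}. a n j * L (R n * P j))"
    proof (rule sum.mono_neutral_right)
      show "\<forall>j\<in>{n - 2..n + 2} - {n - 2}. a n j * L (R n * P j) = 0"
      proof
        fix j assume "j \<in> {n - 2..n + 2} - {n - 2}"
        hence "degree (R n) < j" using degree_R[of n] by auto
        thus "a n j * L (R n * P j) = 0" by (simp add: orth_low)
      qed
    qed simp_all
    moreover have "L (R n * P (n - 2)) \<noteq> 0"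
      using orth_lead_nz[OF degree_R R_nz[OF that]] .
    ultimately show ?thesis using val[OF that, of n] assms(1)[OF that] by simp
  qed
  have comm: "L (R m * R n * \<pi>) = L (R n * R m * \<pi>)" by (simp add: ac_simps)
  show ?thesis using less[of m n] less[of n m] eq[of n] assms(3,4) comm
    by (cases m n rule: linorder_cases) auto
qed

end

context D2_orthogonal
begin

lemma structure_relation:
  assumes "degree \<pi> \<le> 4" "n \<ge> 2"
  shows "\<pi> * R n = (\<Sum>m = n - 2..n + 2. cst (L (\<pi> * R n * P m) / d m) * P m)"
    and "L (\<pi> * R n * P (n - 2)) \<noteq> 0"
proof -
  define g where "g m = antidifference (antidifference (P m))" for m
  have g: "D (D (g m)) = P m" "degree (g m) \<le> m + 2" for m
    using degree_antidifference[of "antidifference (P m)"] degree_antidifference[of "P m"] degree_P[of m] by (simp_all add: g_def D_antidifference)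
  have val: "L (\<pi> * R n * P m) = norm_ratio n * L (g m * P n)" for m
    using pairing_R[OF assms(2), of "g m"] by (simp add: g(1) ac_simps)
  show "\<pi> * R n = (\<Sum>m = n - 2..n + 2. cst (L (\<pi> * R n * P m) / d m) * P m)"
  proof (rule banded_expansion)
    show "degree (\<pi> * R n) \<le> n + 2"
      using degree_mult_le[of \<pi> "R n"] degree_R[of n] assms by simp
    fix m assume "m + 2 < n"
    thus "L (\<pi> * R n * P m) = 0" using val[of m] g(2)[of m] by (simp add: orth_low)
  qed
  have "degree (g (n - 2)) = n"
  proof (rule antisym)
    show "degree (g (n - 2)) \<le> n" using g(2)[of "n - 2"] assms(2) by simp
    have "degree (g (n - 2)) - 2 = n - 2"
      using degree_P[of "n - 2"] degree_D[of "g (n - 2)"] degree_D[of "D (g (n - 2))"]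
      by (simp add: g(1) numeral_2_eq_2)
    moreover have "degree (g (n - 2)) \<ge> 2"
    proof (rule ccontr)
      assume "\<not> ?thesis"
      hence "degree (D (g (n - 2))) = 0" using degree_D[of "g (n - 2)"] by simp
      then obtain c where "D (g (n - 2)) = [:c:]" by (rule degree_eq_zeroE)
      thus False using g(1)[of "n - 2"] D_cst[of c] P_nz[of "n - 2"] by (simp add: cst_def)
    qed
    ultimately show "n \<le> degree (g (n - 2))" by simp
  qed
  moreover from this have "g (n - 2) \<noteq> 0" using assms(2) by auto
  ultimately show "L (\<pi> * R n * P (n - 2)) \<noteq> 0"
    using val[of "n - 2"] norm_ratio_nz[OF assms(2)] orth_lead_nz[of "g (n - 2)" n] by simp
qed

end

context hypergeometric_polynomials
begin

lemma degree_pi: "degree \<pi> \<le> 4"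
proof -
  have "degree (\<phi> ^ 2) \<le> 4" using degree_power_le[of \<phi> 2] degree_phi by simp
  moreover have "degree (U * \<psi> ^ 2) \<le> 4"
    using degree_mult_le[of U "\<psi> ^ 2"] degree_power_le[of \<psi> 2] degree_U degree_psi by simp
  ultimately show ?thesis unfolding \<pi>_def by (rule degree_diff_le)
qed

text \<open>
Green's formula moves \<open>T'\<close> away from \<open>P n\<close>, so that only the eigenvalue and an inner product with
\<open>P n\<close> itself remain.
\<close>

lemma pi_R_pairing:
  assumes "D k = \<psi> * h"
  shows "L (\<pi> * R n * h) = \<mu> n * L ((\<phi> * h + S k) * P n)"
proof -
  have "\<pi> * R n * h = cst (\<mu> n) * (\<phi> * h * P n) - D k * T' (P n)"
    unfolding pi_DD eigen assms by (simp add: algebra_simps)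
  hence "L (\<pi> * R n * h) = \<mu> n * L (\<phi> * h * P n) - L (D k * T' (P n))" by (simp only: Ll)
  also have "L (D k * T' (P n)) = - (\<mu> n * L (S k * P n))"
    using green[of k "P n"] by (simp add: eigen Ll mult.left_commute[of "S k"])
  finally show ?thesis by (simp add: distrib_right Ll distrib_left)
qed

lemma pi_R_low:
  assumes "m + 2 < n"
  shows "L (\<pi> * R n * P m) = 0"
proof -
  obtain k where k: "D k = \<psi> * P m" "degree k \<le> degree (\<psi> * P m) + 1" using D_surj by blast
  have "degree (\<psi> * P m) \<le> m + 1" using degree_mult_le[of \<psi> "P m"] degree_psi degree_P[of m] by simp
  hence "degree (S k) \<le> m + 2" using degree_S_le[of k] k(2) by simp
  moreover have "degree (\<phi> * P m) \<le> m + 2" using degree_mult_le[of \<phi> "P m"] degree_phi degree_P[of m] by simp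
  ultimately have "degree (\<phi> * P m + S k) \<le> m + 2" by (intro degree_add_le)
  thus ?thesis using pi_R_pairing[OF k(1), of n] assms by (simp add: orth_low)
qed

text \<open>
With \<open>n = m + 2\<close>, the coefficient of \<open>\<phi> P m + S k\<close> at degree \<open>n\<close> is proportional to the factor of the
eigenvalue at \<open>n + 1\<close> given by \<open>mu_lead\<close>, so two nonzero eigenvalues multiply.
\<close>

lemma pi_R_extreme: "L (\<pi> * R (m + 2) * P m) \<noteq> 0"
proof -
  let ?n = "Suc (Suc m)"
  obtain k where k: "D k = \<psi> * P m" "degree k \<le> degree (\<psi> * P m) + 1" using D_surj by blast
  have dp: "degree (\<psi> * P m) \<le> m + 1" using degree_mult_le[of \<psi> "P m"] degree_psi degree_P[of m] by simp
  hence dk: "degree k \<le> ?n" using k(2) by simp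
  hence dS: "degree (S k) \<le> ?n" using degree_S_le[of k] by simp
  have dphi: "degree (\<phi> * P m) \<le> ?n" using degree_mult_le[of \<phi> "P m"] degree_phi degree_P[of m] by simp
  have "coeff (\<psi> * P m) (1 + m) = coeff \<psi> 1 * coeff (P m) m"
    by (rule coeff_mult_top) (simp_all add: degree_psi degree_P)
  hence ck: "lead_D \<alpha> ?n * coeff k ?n = coeff \<psi> 1 * coeff (P m) m"
    using coeff_D[OF dk] k(1) by simp
  have "coeff (\<phi> * P m) (2 + m) = coeff \<phi> 2 * coeff (P m) m"
    by (rule coeff_mult_top) (simp_all add: degree_phi degree_P)
  hence "lead_D \<alpha> ?n * coeff (\<phi> * P m + S k) ?n
      = lead_D \<alpha> ?n * coeff \<phi> 2 * coeff (P m) m + lead_S \<alpha> ?n * (lead_D \<alpha> ?n * coeff k ?n)"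
    using coeff_S[OF dk] by (simp add: algebra_simps del: lead_D.simps lead_S.simps)
  also have "\<dots> = (coeff \<phi> 2 * lead_D \<alpha> ?n + coeff \<psi> 1 * lead_S \<alpha> ?n) * coeff (P m) m"
    unfolding ck by (simp add: algebra_simps del: lead_D.simps lead_S.simps)
  also have "\<dots> \<noteq> 0"
    using mu_lead[of ?n] mu_nz[of "Suc ?n"] lead_P[of m] by (simp del: lead_D.simps lead_S.simps)
  finally have "coeff (\<phi> * P m + S k) ?n \<noteq> 0" by auto
  hence "L ((\<phi> * P m + S k) * P ?n) \<noteq> 0"
    using orth_lead[OF degree_add_le[OF dphi dS]] lead_P[of ?n] d_nz[of ?n] by simp
  thus ?thesis using pi_R_pairing[OF k(1), of ?n] mu_nz[of ?n] by simp
qed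

lemma structure_relation:
  "\<pi> * R n = (\<Sum>m = n - 2..n + 2. cst (L (\<pi> * R n * P m) / d m) * P m)"
proof (rule banded_expansion)
  show "degree (\<pi> * R n) \<le> n + 2"
  proof (cases "n < 2")
    case True
    hence "degree (D (P n)) = 0" using degree_D[of "P n"] degree_P[of n] by simp
    then obtain c where "D (P n) = [:c:]" by (rule degree_eq_zeroE)
    thus ?thesis using D_cst[of c] by (simp add: cst_def)
  next
    case False
    thus ?thesis using degree_mult_le[of \<pi> "R n"] degree_R[of n] degree_pi by simp
  qed
qed (rule pi_R_low)

end

section \<open>Lattices, weights and the characterisation\<close>

text \<open>
Adding the neighbouring half steps multiplies both \<open>q powr s\<close> and \<open>q powr (- s)\<close> by \<open>r + 1/r\<close>, where
\<open>r = q powr (1/2)\<close>; hence \<open>\<alpha> = (r + 1/r)/2\<close>, and \<open>\<beta>\<close> is chosen so that \<open>c3\<close> is fixed. Subtracting them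
multiplies the two terms by opposite factors, and the square of a difference is that of the sum minus
a constant. For \<open>q = 1\<close>, \<open>\<alpha> = 1\<close>.
\<close>

lemma lattice_parameters:
  assumes "q > 0" "nonuniform_lattice q x"
  obtains \<alpha> \<beta> \<delta> :: real where "\<alpha> \<ge> 1"
    "\<And>s. (x (s + 1/2) + x (s - 1/2)) / 2 = \<alpha> * x s + \<beta>"
    "\<And>s. ((x (s + 1/2) - x (s - 1/2)) / 2)\<^sup>2 = (\<alpha>\<^sup>2 - 1) * (x s)\<^sup>2 + 2 * \<beta> * (\<alpha> + 1) * x s + \<delta>"
proof -
  consider (Q) c1 c2 c3 where "x = (\<lambda>s. c1 * q powr (- s) + c2 * q powr s + c3)"
    | (L) c4 c5 c6 where "x = (\<lambda>s. c4 * s\<^sup>2 + c5 * s + c6)"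
    using assms(2) unfolding nonuniform_lattice_def by blast
  thus thesis
  proof cases
    case Q
    define r where "r = q powr (1/2)"
    have r: "r > 0" using assms(1) by (simp add: r_def)
    note sh = powr_half_shift[OF assms(1), folded r_def] powr_minus_divide[of q]
    define \<alpha> where "\<alpha> = (r + 1/r) / 2"
    have sq: "\<alpha>\<^sup>2 - 1 = ((r - 1/r) / 2)\<^sup>2"
      using r by (simp add: \<alpha>_def field_simps power2_eq_square)
    have "\<alpha> \<ge> 1"
    proof -
      have "0 \<le> (r - 1)\<^sup>2" by simp
      thus ?thesis using r by (simp add: \<alpha>_def field_simps power2_eq_square)
    qed
    moreover have "(x (s + 1/2) + x (s - 1/2)) / 2 = \<alpha> * x s + c3 * (1 - \<alpha>)" for s
    proof -
      define y where "y = q powr s"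
      have "y \<noteq> 0" using assms(1) by (simp add: y_def)
      thus ?thesis unfolding Q sh y_def[symmetric] \<alpha>_def using r by (simp add: field_simps)
    qed
    moreover have "((x (s + 1/2) - x (s - 1/2)) / 2)\<^sup>2
        = (\<alpha>\<^sup>2 - 1) * (x s)\<^sup>2 + 2 * (c3 * (1 - \<alpha>)) * (\<alpha> + 1) * x s
          + (\<alpha>\<^sup>2 - 1) * (c3\<^sup>2 - 4 * c1 * c2)" for s
    proof -
      define y z where "y = q powr s" and "z = c1 / y + c2 * y"
      have y: "y \<noteq> 0" using assms(1) by (simp add: y_def)
      have "(x (s + 1/2) - x (s - 1/2)) / 2 = (r - 1/r) / 2 * (c2 * y - c1 / y)"
        unfolding Q sh y_def[symmetric] using r y by (simp add: field_simps)
      hence "((x (s + 1/2) - x (s - 1/2)) / 2)\<^sup>2 = (\<alpha>\<^sup>2 - 1) * (c2 * y - c1 / y)\<^sup>2"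
        unfolding sq by (simp only: power_mult_distrib)
      also have "(c2 * y - c1 / y)\<^sup>2 = z\<^sup>2 - 4 * c1 * c2"
        unfolding z_def using y by (simp add: power2_eq_square field_simps)
      also have "z = x s - c3" unfolding Q sh z_def y_def by simp
      finally show ?thesis by (simp add: power2_eq_square algebra_simps)
    qed
    ultimately show ?thesis by (rule that)
  next
    case L
    show ?thesis
      by (rule that[of 1 "c4 / 4" "c5\<^sup>2 / 4 - c4 * c6"])
        (simp_all add: L field_simps power2_eq_square)
  qed
qed

lemma lattice_calculus_Dx_Sx:
  assumes q: "q > 0" and x: "nonuniform_lattice q x"
  shows "\<exists>\<alpha> \<beta> \<delta>. lattice_calculus (Dx x) (Sx x) \<alpha> \<beta> \<delta>"
proof (rule lattice_parameters[OF q x])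
  fix \<alpha> \<beta> \<delta> :: real
  assume al: "\<alpha> \<ge> 1"
    and mean: "\<And>s. (x (s + 1/2) + x (s - 1/2)) / 2 = \<alpha> * x s + \<beta>"
    and sq: "\<And>s. ((x (s + 1/2) - x (s - 1/2)) / 2)\<^sup>2 = (\<alpha>\<^sup>2 - 1) * (x s)\<^sup>2 + 2 * \<beta> * (\<alpha> + 1) * x s + \<delta>"
  note Dxp = poly_Dx[OF q x] and Sxp = poly_Sx[OF q x]
  note uniq = lattice_poly_unique[OF q x]
  have "lattice_calculus (Dx x) (Sx x) \<alpha> \<beta> \<delta>"
  proof
    show "\<alpha> \<ge> 1" by (rule al)
    show "linear_op (Dx x)" unfolding linear_op_def
      by (auto intro!: uniq simp: Dxp Sxp add_divide_distrib diff_divide_distrib right_diff_distrib)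
    show "linear_op (Sx x)" unfolding linear_op_def
      by (auto intro!: uniq simp: Dxp Sxp add_divide_distrib distrib_left)
    show "Dx x 1 = 0" by (rule uniq) (simp add: Dxp Sxp)
    show "Sx x 1 = 1" by (rule uniq) (simp add: Dxp Sxp)
    fix f
    show "Dx x (var * f) = Sx x f + (cst \<alpha> * var + cst \<beta>) * Dx x f"
    proof (rule uniq)
      fix s assume s: "x (s + 1/2) \<noteq> x (s - 1/2)"
      define u v F G where "u = x (s + 1/2)" "v = x (s - 1/2)" "F = poly f u" "G = poly f v"
      note d = this
      have "(u * F - v * G) / (u - v) = (F + G) / 2 + (u + v) / 2 * ((F - G) / (u - v))"
        using s[folded d] by (simp add: field_simps)
      thus "poly (Dx x (var * f)) (x s) = poly (Sx x f + (cst \<alpha> * var + cst \<beta>) * Dx x f) (x s)"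
        using mean[of s] by (simp add: Dxp[OF s] Sxp d)
    qed
    show "Sx x (var * f) = ((cst \<alpha> ^ 2 - 1) * var ^ 2 + 2 * cst \<beta> * (cst \<alpha> + 1) * var + cst \<delta>) * Dx x f
        + (cst \<alpha> * var + cst \<beta>) * Sx x f"
    proof (rule uniq)
      fix s assume s: "x (s + 1/2) \<noteq> x (s - 1/2)"
      define u v F G where "u = x (s + 1/2)" "v = x (s - 1/2)" "F = poly f u" "G = poly f v"
      note d = this
      have "((u - v) / 2)\<^sup>2 * ((F - G) / (u - v)) = (u - v) * (F - G) / 4"
      proof -
        have "(z / 2)\<^sup>2 * (y / z) = z * y / 4" if "z \<noteq> 0" for y z :: real
          using that by (simp add: power2_eq_square)
        thus ?thesis using s[folded d] by simp
      qed
      moreover have "(u * F + v * G) / 2 = (u - v) * (F - G) / 4 + (u + v) / 2 * ((F + G) / 2)"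
        by (simp add: field_simps)
      ultimately have "(u * F + v * G) / 2 = ((u - v) / 2)\<^sup>2 * ((F - G) / (u - v)) + (u + v) / 2 * ((F + G) / 2)"
        by (simp only:)
      thus "poly (Sx x (var * f)) (x s) = poly (((cst \<alpha> ^ 2 - 1) * var ^ 2
          + 2 * cst \<beta> * (cst \<alpha> + 1) * var + cst \<delta>) * Dx x f + (cst \<alpha> * var + cst \<beta>) * Sx x f) (x s)"
        using mean[of s] sq[of s] by (simp add: Dxp[OF s] Sxp d)
    qed
  qed
  thus ?thesis by blast
qed

text \<open>
Integrability of the products \<open>P m P n w\<close> gives integrability of \<open>f w\<close> for every polynomial \<open>f\<close>,
because \<open>P 0\<close> is a nonzero constant and the \<open>P n\<close> span all polynomials.
\<close>

lemma weight_functional: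
  fixes a b :: ereal and w :: "real \<Rightarrow> real" and P :: "nat \<Rightarrow> real poly"
  assumes deg: "\<And>n. degree (P n) = n" and orth: "orthogonal_polys a b w P"
  defines "L \<equiv> \<lambda>f. LBINT t=a..b. poly f t * w t"
  shows "\<And>f. interval_lebesgue_integrable lborel a b (\<lambda>t. poly f t * w t)"
    and "\<exists>d. orthogonal_basis L P d"
proof -
  from orth obtain d where int: "\<And>m n. interval_lebesgue_integrable lborel a b (\<lambda>t. poly (P m) t * poly (P n) t * w t)"
    and d: "\<And>n. d n > 0"
    and val: "\<And>m n. (LBINT t=a..b. poly (P m) t * poly (P n) t * w t) = (if m = n then d n else 0)"
    unfolding orthogonal_polys_def by blast
  let ?I = "\<lambda>f. interval_lebesgue_integrable lborel a b (\<lambda>t. poly f t * w t)"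
  have P_nz: "P n \<noteq> 0" for n
  proof
    assume "P n = 0"
    thus False using val[of n n] d[of n] by simp
  qed
  have I_add: "?I f \<Longrightarrow> ?I g \<Longrightarrow> ?I (f + g)" for f g
    using interval_lebesgue_integral_add(1)[of lborel a b "\<lambda>t. poly f t * w t" "\<lambda>t. poly g t * w t"]
    by (simp add: distrib_right)
  have I_cst: "?I f \<Longrightarrow> ?I (cst c * f)" for c f
    using interval_lebesgue_integrable_mult_right[of c lborel a b "\<lambda>t. poly f t * w t"]
    by (simp add: mult.assoc)
  obtain c where c: "P 0 = cst c" "c \<noteq> 0"
    using deg[of 0] P_nz[of 0] degree_eq_zeroE[of "P 0"] unfolding cst_def by (metis pCons_0_0)
  have I_P: "?I (P n)" for n
  proof -
    have "?I (P n * P 0)" using int[of n 0] by simp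
    hence "?I (cst (1 / c) * (P n * P 0))" by (rule I_cst)
    thus ?thesis using c by (simp add: mult.assoc)
  qed
  show I: "?I f" for f
  proof -
    obtain e where e: "f = (\<Sum>m<Suc (degree f). cst (e m) * P m)"
      using graded_expansion[of P, OF deg P_nz, of "Suc (degree f)" f] by (auto simp: coeff_eq_0)
    have "?I 0" using I_cst[OF I_P[of 0], of 0] by (simp add: cst_hom)
    hence "?I (\<Sum>m<N. cst (e m) * P m)" for N
    proof (induction N)
      case (Suc N)
      show ?case unfolding sum.lessThan_Suc by (intro I_add Suc I_cst I_P)
    qed simp
    thus ?thesis using e by metis
  qed
  have "orthogonal_basis L P d"
  proof
    show "linear_functional L"
      unfolding linear_functional_def
    proof (intro conjI allI)
      fix f g c
      show "L (f + g) = L f + L g"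
        using interval_lebesgue_integral_add(2)[OF I[of f] I[of g]] by (simp add: L_def distrib_right)
      show "L (cst c * f) = c * L f" by (simp add: L_def mult.assoc)
    qed
    show "degree (P n) = n" for n by (rule deg)
    show "L (P m * P n) = (if m = n then d n else 0)" for m n using val[of m n] by (simp add: L_def)
    show "d n \<noteq> 0" for n using d[of n] by simp
  qed
  thus "\<exists>d. orthogonal_basis L P d" by blast
qed

theorem theorem4p2:
  fixes q :: real and x :: "real \<Rightarrow> real" and a b :: ereal
    and w :: "real \<Rightarrow> real" and P :: "nat \<Rightarrow> real poly"
  assumes "q > 0" and "nonuniform_lattice q x"
    and "a < b" and "\<forall>t\<in>einterval a b. w t > 0"
    and "\<forall>n. degree (P n) = n"
    and "orthogonal_polys a b w P"
  shows "let
      A = (\<exists>(p :: real poly) (\<alpha> :: nat \<Rightarrow> nat \<Rightarrow> real). degree p \<le> 4 \<and>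
        (\<forall>n\<ge>2. \<alpha> n (n - 2) \<noteq> 0 \<and>
          p * Dx x (Dx x (P n)) = (\<Sum>m = n - 2..n + 2. smult (\<alpha> n m) (P m))));
      B = (\<exists>p :: real poly. degree p \<le> 4 \<and> orthogonal_D2 x a b (\<lambda>t. poly p t * w t) P);
      C = (\<exists>(\<phi> :: real poly) (\<psi> :: real poly) (l :: nat \<Rightarrow> real).
        degree \<phi> \<le> 2 \<and> degree \<psi> = 1 \<and>
        (\<forall>n\<ge>5. \<phi> * Dx x (Dx x (P n)) + \<psi> * Sx x (Dx x (P n)) + smult (l n) (P n) = 0))
    in (A \<longleftrightarrow> B) \<and> (B \<longleftrightarrow> C)"
proof -
  define L where "L f = (LBINT t=a..b. poly f t * w t)" for f
  have deg: "degree (P n) = n" for n using assms(5) by simp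
  note integrable = weight_functional(1)[OF deg assms(6)]
  obtain d where "orthogonal_basis (\<lambda>f. LBINT t=a..b. poly f t * w t) P d"
    using weight_functional(2)[OF deg assms(6)] by blast
  hence basis: "orthogonal_basis L P d" unfolding L_def[abs_def] .
  obtain \<alpha> \<beta> \<delta> where calc: "lattice_calculus (Dx x) (Sx x) \<alpha> \<beta> \<delta>"
    using lattice_calculus_Dx_Sx[OF assms(1,2)] by blast
  interpret lattice_polynomials "Dx x" "Sx x" \<alpha> \<beta> \<delta> L P d
    by (intro lattice_polynomials.intro calc basis)
  have D2: "orthogonal_D2 x a b (\<lambda>t. poly p t * w t) P
      \<longleftrightarrow> (\<forall>m\<ge>2. \<forall>n\<ge>2. L (R m * R n * p) = 0 \<longleftrightarrow> m \<noteq> n)" for p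
    using integrable[of "R _ * R _ * p"]
    by (simp add: orthogonal_D2_def L_def mult.assoc)
  define St where "St p \<longleftrightarrow> (\<exists>\<alpha>. \<forall>n\<ge>2. \<alpha> n (n - 2) \<noteq> 0 \<and>
      p * R n = (\<Sum>m = n - 2..n + 2. smult (\<alpha> n m) (P m)))" for p
  have St_D2: "orthogonal_D2 x a b (\<lambda>t. poly p t * w t) P" if "St p" for p
  proof -
    obtain s where s: "\<And>n. n \<ge> 2 \<Longrightarrow> s n (n - 2) \<noteq> 0"
      "\<And>n. n \<ge> 2 \<Longrightarrow> p * R n = (\<Sum>m = n - 2..n + 2. cst (s n m) * P m)"
      using \<open>St p\<close> unfolding St_def smult_cst by blast
    show ?thesis unfolding D2 using structure_relation_imp_orthogonal[of s p] s by blast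
  qed
  have D2_locale: "D2_orthogonal (Dx x) (Sx x) \<alpha> \<beta> \<delta> L P d p"
    if "orthogonal_D2 x a b (\<lambda>t. poly p t * w t) P" for p
    by unfold_locales (use that D2 in blast)
  have D2_St: "St p" if p: "degree p \<le> 4" "orthogonal_D2 x a b (\<lambda>t. poly p t * w t) P" for p
  proof -
    interpret O: D2_orthogonal "Dx x" "Sx x" \<alpha> \<beta> \<delta> L P d p by (rule D2_locale[OF p(2)])
    show ?thesis
      unfolding St_def smult_cst using O.structure_relation[OF p(1)] d_nz
      by (intro exI[of _ "\<lambda>n m. L (p * R n * P m) / d m"]) simp
  qed
  have D2_C: "\<exists>\<phi> \<psi> l. degree \<phi> \<le> 2 \<and> degree \<psi> = 1 \<and>
      (\<forall>n\<ge>5. \<phi> * R n + \<psi> * Sx x (Dx x (P n)) + smult (l n) (P n) = 0)"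
    if p: "orthogonal_D2 x a b (\<lambda>t. poly p t * w t) P" for p
  proof -
    interpret O: D2_orthogonal "Dx x" "Sx x" \<alpha> \<beta> \<delta> L P d p by (rule D2_locale[OF p])
    obtain l where "\<And>n. O.\<phi> * R n + O.\<psi> * Sx x (Dx x (P n)) + smult (l n) (P n) = 0"
      using O.difference_equation unfolding smult_cst by metis
    moreover have "degree O.\<psi> = 1" by (simp add: O.\<psi>_def deg)
    ultimately show ?thesis using O.degree_phi by blast
  qed
  have C_St: "\<exists>p. degree p \<le> 4 \<and> St p"
    if "degree \<phi> \<le> 2" "degree \<psi> = 1"
      and eq: "\<And>n. n \<ge> 5 \<Longrightarrow> \<phi> * R n + \<psi> * Sx x (Dx x (P n)) + smult (l n) (P n) = 0" for \<phi> \<psi> l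
  proof -
    interpret H0: hypergeometric_operator "Dx x" "Sx x" \<alpha> \<beta> \<delta> L P d \<phi> \<psi>
      by unfold_locales (use that in auto)
    interpret H: hypergeometric_polynomials "Dx x" "Sx x" \<alpha> \<beta> \<delta> L P d \<phi> \<psi>
    proof
      fix n :: nat assume "n \<ge> 5"
      from eq[OF this] have "H0.T (P n) = cst (- l n) * P n"
        unfolding H0.T_def smult_cst by (simp add: cst_hom eq_neg_iff_add_eq_0)
      thus "\<exists>\<mu>. H0.T (P n) = cst \<mu> * P n" by blast
    qed
    have "St H0.\<pi>"
      unfolding St_def smult_cst
    proof (intro exI[of _ "\<lambda>n m. L (H0.\<pi> * R n * P m) / d m"] allI impI conjI)
      fix n :: nat assume "n \<ge> 2"
      hence "n - 2 + 2 = n" by simp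
      thus "L (H0.\<pi> * R n * P (n - 2)) / d (n - 2) \<noteq> 0"
        using H.pi_R_extreme[of "n - 2"] d_nz[of "n - 2"] by (simp only:) simp
    qed (rule H.structure_relation)
    thus ?thesis using H.degree_pi by blast
  qed
  have AB: "(\<exists>p. degree p \<le> 4 \<and> St p) \<longleftrightarrow> (\<exists>p. degree p \<le> 4 \<and> orthogonal_D2 x a b (\<lambda>t. poly p t * w t) P)"
    using St_D2 D2_St by blast
  have "(\<exists>p. degree p \<le> 4 \<and> orthogonal_D2 x a b (\<lambda>t. poly p t * w t) P)
      \<longleftrightarrow> (\<exists>\<phi> \<psi> l. degree \<phi> \<le> 2 \<and> degree \<psi> = 1 \<and>
        (\<forall>n\<ge>5. \<phi> * R n + \<psi> * Sx x (Dx x (P n)) + smult (l n) (P n) = 0))"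
    (is "?B \<longleftrightarrow> ?C")
  proof
    assume ?B
    thus ?C by (elim exE conjE) (rule D2_C)
  next
    assume ?C
    then obtain \<phi> \<psi> l where C: "degree \<phi> \<le> 2" "degree \<psi> = 1"
      "\<forall>n\<ge>5. \<phi> * R n + \<psi> * Sx x (Dx x (P n)) + smult (l n) (P n) = 0"
      by (elim exE conjE) (rule that)
    have "\<exists>p. degree p \<le> 4 \<and> St p" by (rule C_St[OF C(1,2) C(3)[rule_format]])
    thus ?B using AB by simp
  qed
  moreover have "(\<exists>p \<alpha>. degree p \<le> 4 \<and> (\<forall>n\<ge>2. \<alpha> n (n - 2) \<noteq> 0 \<and>
      p * R n = (\<Sum>m = n - 2..n + 2. smult (\<alpha> n m) (P m)))) \<longleftrightarrow> (\<exists>p. degree p \<le> 4 \<and> St p)"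
    unfolding St_def by (intro ex_cong1) (simp only: ex_simps)
  ultimately show ?thesis unfolding Let_def using AB by (simp only:)
qed

end
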